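(* For all integers $k>1$ with $k\equiv1\pmod{q-1}$, $$\mathrm{ev}_\theta\det\big[\mathcal E_1\ \ (k-1)\mathcal E_k\big]=-\widetilde\pi\,\partial_{k-1}E^{(k-1)}$$ as functions on $\Omega$, where $[\mathcal H_1\ \mathcal H_2]$ is the $2\times2$ matrix with columns $\mathcal H_1,\mathcal H_2$ and $\mathrm{ev}_\theta$ is evaluation at $t=\theta$ of its entries.
   Context: Notation: $q$ a prime power, $A=\mathbb F_q[\theta]$, $A_+$ the monic elements, $\mathbb C_\infty$ the completion of an algebraic closure of $K_\infty=\mathbb F_q((1/\theta))$, $\Omega=\mathbb C_\infty\setminus K_\infty$. For $a\in A$, $a(t)$ is its image under $\theta\mapsto t$. $\mathcal E_k(z)=\sum_{(a,b)\in A^2\setminus\{(0,0)\}}(az+b)^{-k}\binom{a(t)}{b(t)}$; for each $z$, its coordinates are power series in $t$ which converge at $t=\theta$ (they extend to entire functions of $t$), and $\mathrm{ev}_\theta$ denotes the value at $t=\theta$. $\widetilde\pi$ is the Carlitz period. $E^{(n)}(z)=\sum_{(a,b)\in A^2\setminus\{(0,0)\}}(az+b)^{-n}$ (Goss' Eisenstein series). $E(z)=\widetilde\pi^{-1}\sum_{a\in A_+}\sum_{b\in A}\frac{a}{az+b}$ is Gekeler's false Eisenstein series (equal to $\sum_{a\in A_+}a\,u(az)$ near infinity, with $u(z)=\widetilde\pi^{-1}\sum_{a\in A}(z-a)^{-1}$). For an integer $n$ and a rigid analytic $f:\Omega\to\mathbb C_\infty$, $\partial_nf:=\widetilde\pi^{-1}\frac{df}{dz}+n\,E\,f$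 (Gekeler's Ramanujan–Serre derivative). *)

theory Defs
  imports Complex_Main "HOL-Computational_Algebra.Polynomial"
begin

text \<open>
  Setting.  C_infinity is modelled by an arbitrary field type 'c together with an
  absolute value v :: 'c => real (the characteristic-p field cannot be a real
  normed space, so the library's norm classes do not apply).  The assumptions in
  Cinf_setting characterise C_infinity: characteristic p with q = p^e, v a
  non-archimedean absolute value, complete, algebraically closed, theta with
  v theta > 1 (so F_q(theta) carries the infinite place), and every element is a
  limit of elements algebraic over K_infinity (the closure of F_q(theta)), i.e.
  'c is the completion of an algebraic closure of K_infinity.
  Elements of A = F_q[theta] are represented by polynomials with coefficients
  in F_q = roots of X^q - X; a(t) is that polynomial, a = poly a theta.
\<close>

definition nonarch_abs :: "('c::field \<Rightarrow> real) \<Rightarrow> bool" where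
  "nonarch_abs v \<longleftrightarrow> (\<forall>x. 0 \<le> v x) \<and> (\<forall>x. v x = 0 \<longleftrightarrow> x = 0)
     \<and> (\<forall>x y. v (x * y) = v x * v y) \<and> (\<forall>x y. v (x + y) \<le> max (v x) (v y))"

definition v_complete :: "('c::field \<Rightarrow> real) \<Rightarrow> bool" where
  "v_complete v \<longleftrightarrow> (\<forall>X::nat \<Rightarrow> 'c.
     (\<forall>e>0. \<exists>N. \<forall>m\<ge>N. \<forall>n\<ge>N. v (X m - X n) < e) \<longrightarrow>
     (\<exists>l. (\<lambda>n. v (X n - l)) \<longlonglongrightarrow> 0))"

definition Fq :: "nat \<Rightarrow> 'c::field set" where
  "Fq q = {x. x ^ q = x}"

definition Apoly :: "nat \<Rightarrow> 'c::field poly set" where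
  "Apoly q = {a. \<forall>i. coeff a i \<in> Fq q}"

definition Amonic :: "nat \<Rightarrow> 'c::field poly set" where
  "Amonic q = {a \<in> Apoly q. lead_coeff a = 1}"

definition Kfrac :: "nat \<Rightarrow> 'c::field \<Rightarrow> 'c set" where
  "Kfrac q \<theta> = {poly a \<theta> / poly b \<theta> | a b. a \<in> Apoly q \<and> b \<in> Apoly q \<and> b \<noteq> 0}"

definition K_inf :: "('c::field \<Rightarrow> real) \<Rightarrow> nat \<Rightarrow> 'c \<Rightarrow> 'c set" where
  "K_inf v q \<theta> = {x. \<exists>X. (\<forall>n. X n \<in> Kfrac q \<theta>) \<and> (\<lambda>n. v (X n - x)) \<longlonglongrightarrow> 0}"

definition alg_over :: "'c::field set \<Rightarrow> 'c \<Rightarrow> bool" where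
  "alg_over S x \<longleftrightarrow> (\<exists>p. p \<noteq> 0 \<and> (\<forall>i. coeff p i \<in> S) \<and> poly p x = 0)"

definition Cinf_setting :: "('c::field \<Rightarrow> real) \<Rightarrow> nat \<Rightarrow> 'c \<Rightarrow> bool" where
  "Cinf_setting v q \<theta> \<longleftrightarrow>
     (\<exists>p e. prime p \<and> 0 < e \<and> q = p ^ e \<and> of_nat p = (0::'c))
     \<and> nonarch_abs v \<and> v_complete v
     \<and> (\<forall>P::'c poly. 0 < degree P \<longrightarrow> (\<exists>x. poly P x = 0))
     \<and> 1 < v \<theta>
     \<and> (\<forall>x. \<exists>X. (\<forall>n. alg_over (K_inf v q \<theta>) (X n)) \<and> (\<lambda>n. v (X n - x)) \<longlonglongrightarrow> 0)"

definition Omega :: "('c::field \<Rightarrow> real) \<Rightarrow> nat \<Rightarrow> 'c \<Rightarrow> 'c set" where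
  "Omega v q \<theta> = UNIV - K_inf v q \<theta>"

definition has_vsum :: "('c::field \<Rightarrow> real) \<Rightarrow> ('i \<Rightarrow> 'c) \<Rightarrow> 'i set \<Rightarrow> 'c \<Rightarrow> bool" where
  "has_vsum v f X l \<longleftrightarrow> ((\<lambda>S. v (sum f S - l)) \<longlongrightarrow> 0) (finite_subsets_at_top X)"

definition vsum :: "('c::field \<Rightarrow> real) \<Rightarrow> ('i \<Rightarrow> 'c) \<Rightarrow> 'i set \<Rightarrow> 'c" where
  "vsum v f X = (if \<exists>l. has_vsum v f X l then THE l. has_vsum v f X l else 0)"

definition carlitz_D :: "nat \<Rightarrow> 'c::field \<Rightarrow> nat \<Rightarrow> 'c" where
  "carlitz_D q \<theta> i = (\<Prod>j<i. \<theta> ^ (q ^ i) - \<theta> ^ (q ^ j))"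

definition carlitz_exp :: "('c::field \<Rightarrow> real) \<Rightarrow> nat \<Rightarrow> 'c \<Rightarrow> 'c \<Rightarrow> 'c" where
  "carlitz_exp v q \<theta> z = vsum v (\<lambda>i. z ^ (q ^ i) / carlitz_D q \<theta> i) UNIV"

definition carlitz_period :: "('c::field \<Rightarrow> real) \<Rightarrow> nat \<Rightarrow> 'c \<Rightarrow> 'c \<Rightarrow> bool" where
  "carlitz_period v q \<theta> \<pi> \<longleftrightarrow> \<pi> \<noteq> 0 \<and>
     {z. carlitz_exp v q \<theta> z = 0} = {poly a \<theta> * \<pi> | a. a \<in> Apoly q}"

definition goss_eis :: "('c::field \<Rightarrow> real) \<Rightarrow> nat \<Rightarrow> 'c \<Rightarrow> nat \<Rightarrow> 'c \<Rightarrow> 'c" where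
  "goss_eis v q \<theta> n z = vsum v (\<lambda>(a, b). inverse ((poly a \<theta> * z + poly b \<theta>) ^ n))
      (Apoly q \<times> Apoly q - {(0, 0)})"

definition false_eis :: "('c::field \<Rightarrow> real) \<Rightarrow> nat \<Rightarrow> 'c \<Rightarrow> 'c \<Rightarrow> 'c \<Rightarrow> 'c" where
  "false_eis v q \<theta> \<pi> z = inverse \<pi> *
     vsum v (\<lambda>a. vsum v (\<lambda>b. poly a \<theta> / (poly a \<theta> * z + poly b \<theta>)) (Apoly q)) (Amonic q)"

definition v_at :: "('c::field \<Rightarrow> real) \<Rightarrow> 'c \<Rightarrow> 'c filter" where
  "v_at v z = (INF e\<in>{0<..}. principal {w. w \<noteq> z \<and> v (w - z) < e})"

definition has_vderiv :: "('c::field \<Rightarrow> real) \<Rightarrow> ('c \<Rightarrow> 'c) \<Rightarrow> 'c \<Rightarrow> 'c \<Rightarrow> bool" where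
  "has_vderiv v f z d \<longleftrightarrow> ((\<lambda>w. v ((f w - f z) / (w - z) - d)) \<longlongrightarrow> 0) (v_at v z)"

definition vderiv :: "('c::field \<Rightarrow> real) \<Rightarrow> ('c \<Rightarrow> 'c) \<Rightarrow> 'c \<Rightarrow> 'c" where
  "vderiv v f z = (if \<exists>d. has_vderiv v f z d then THE d. has_vderiv v f z d else 0)"

definition rs_deriv :: "('c::field \<Rightarrow> real) \<Rightarrow> nat \<Rightarrow> 'c \<Rightarrow> 'c \<Rightarrow> int \<Rightarrow> ('c \<Rightarrow> 'c) \<Rightarrow> 'c \<Rightarrow> 'c" where
  "rs_deriv v q \<theta> \<pi> n f z = inverse \<pi> * vderiv v f z + of_int n * false_eis v q \<theta> \<pi> z * f z"

text \<open>ev_theta of a coordinate of the vectorial Eisenstein series E_k(z).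
  sel = fst gives the coordinate with a(t), sel = snd the one with b(t).
  The coordinate is the power series sum_n c_n t^n with
  c_n = sum_{(a,b)} (az+b)^-k [t^n]sel(a,b)(t); ev_theta is its value at t = theta.\<close>
definition vec_eis_coeff :: "('c::field \<Rightarrow> real) \<Rightarrow> nat \<Rightarrow> 'c \<Rightarrow> nat
    \<Rightarrow> ('c poly \<times> 'c poly \<Rightarrow> 'c poly) \<Rightarrow> 'c \<Rightarrow> nat \<Rightarrow> 'c" where
  "vec_eis_coeff v q \<theta> k sel z n = vsum v (\<lambda>ab. inverse ((poly (fst ab) \<theta> * z + poly (snd ab) \<theta>) ^ k)
       * coeff (sel ab) n) (Apoly q \<times> Apoly q - {(0, 0)})"

definition ev_vec_eis :: "('c::field \<Rightarrow> real) \<Rightarrow> nat \<Rightarrow> 'c \<Rightarrow> nat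
    \<Rightarrow> ('c poly \<times> 'c poly \<Rightarrow> 'c poly) \<Rightarrow> 'c \<Rightarrow> 'c" where
  "ev_vec_eis v q \<theta> k sel z = vsum v (\<lambda>n. vec_eis_coeff v q \<theta> k sel z n * \<theta> ^ n) UNIV"

definition det2 :: "'c::comm_ring \<Rightarrow> 'c \<Rightarrow> 'c \<Rightarrow> 'c \<Rightarrow> 'c" where
  "det2 x1 x2 y1 y2 = x1 * y2 - y1 * x2"

end

theory Submission
  imports Defs
begin

text \<open>
  Write \<open>\<lambda>(a, b) = az + b\<close>.  As \<open>z\<close> has positive distance from the rational functions,
  \<open>|\<lambda>(a, b)| \<ge> C max(|a|, |b|)\<close>.  Two facts make the weight one series computable at \<open>t = \<theta>\<close>.
  First, \<open>\<Sum> 1/(x + cw)\<close> over \<open>c\<close> in the finite field equals \<open>\<Sum> (1/(x + cw) - 1/x)\<close>, because the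
  field has zero elements modulo \<open>p\<close>; so it is bounded by \<open>|w|/m\<^sup>2\<close> when all \<open>|x + cw| \<ge> m\<close>.  This gain
  of one power of \<open>m\<close> shows that the series evaluated at \<open>t = \<theta>\<close> is the limit of the finite sums
  \<open>\<Sum> (a, b)/\<lambda>(a, b)\<close> over \<open>deg a, deg b < d\<close>.  Second, \<open>\<Sum> (az + b)/\<lambda>(a, b)\<close> over such a box counts its
  nonzero elements, which gives \<open>-1\<close> in characteristic \<open>p\<close>.  So if the first coordinate of \<open>\<E>\<^sub>1\<close> is
  \<open>-G\<close>, the second is \<open>zG - 1\<close>, and \<open>G\<close> is the period times the false Eisenstein series.
  In weight \<open>k \<ge> 2\<close> all sums converge absolutely, \<open>E\<^sup>(\<^sup>k\<^sup>-\<^sup>1\<^sup>)\<close> is \<open>z\<close> times the first plus the second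
  coordinate of \<open>\<E>\<^sub>k\<close>, its derivative is \<open>-(k - 1)\<close> times the first, and the identity is algebra.
\<close>

section \<open>Non-archimedean fields\<close>

locale nonarch_field =
  fixes v :: "'c::field \<Rightarrow> real"
  assumes nonarch: "nonarch_abs v"
begin

lemma v_nonneg [simp]: "0 \<le> v x"
  and v_eq_0_iff [simp]: "v x = 0 \<longleftrightarrow> x = 0"
  and v_mult: "v (x * y) = v x * v y"
  and v_add_le: "v (x + y) \<le> max (v x) (v y)"
  using nonarch unfolding nonarch_abs_def by auto

lemma v_pos_iff [simp]: "0 < v x \<longleftrightarrow> x \<noteq> 0"
  using v_nonneg[of x] v_eq_0_iff[of x] by linarith

lemma v_1 [simp]: "v 1 = 1"
  using v_mult[of 1 1] v_eq_0_iff[of 1] by simp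

lemma v_0 [simp]: "v 0 = 0"
  by simp

lemma v_minus [simp]: "v (- x) = v x"
proof -
  have "v (-1) * v (-1) = 1"
    using v_mult[of "-1" "-1"] by simp
  then have "v (-1) = 1"
    using v_nonneg[of "-1"] by (metis abs_of_nonneg real_sqrt_abs2 real_sqrt_one)
  then show ?thesis
    using v_mult[of "-1" x] by simp
qed

lemma v_diff_commute: "v (x - y) = v (y - x)"
  using v_minus[of "x - y"] by simp

lemma v_diff_le: "v (x - y) \<le> max (v x) (v y)"
  using v_add_le[of x "- y"] by simp

lemma v_add_bound: "v x \<le> B \<Longrightarrow> v y \<le> B \<Longrightarrow> v (x + y) \<le> B"
  using v_add_le[of x y] by simp

lemma v_diff_bound: "v x \<le> B \<Longrightarrow> v y \<le> B \<Longrightarrow> v (x - y) \<le> B"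
  using v_diff_le[of x y] by simp

lemma v_diff_triangle_le: "v (x - z) \<le> max (v (x - y)) (v (y - z))"
  using v_add_le[of "x - y" "y - z"] by simp

lemma v_inverse: "v (inverse x) = inverse (v x)"
proof (cases "x = 0")
  case False
  then have "v (inverse x) * v x = 1"
    using v_mult[of "inverse x" x] by simp
  then show ?thesis
    by (metis inverse_unique mult.commute)
qed simp

lemma v_divide: "v (x / y) = v x / v y"
  by (simp add: divide_inverse v_mult v_inverse)

lemma v_power: "v (x ^ n) = v x ^ n"
  by (induction n) (simp_all add: v_mult)

lemma v_of_nat_le_1: "v (of_nat n) \<le> 1"
  by (induction n) (auto intro: v_add_bound)

lemma v_sum_le:
  assumes "\<And>x. x \<in> S \<Longrightarrow> v (f x) \<le> B" and "0 \<le> B"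
  shows "v (sum f S) \<le> B"
  using assms by (induction S rule: infinite_finite_induct) (auto intro: v_add_bound)

lemma v_add_eq_left:
  assumes "v y < v x"
  shows "v (x + y) = v x"
proof (rule antisym)
  show "v (x + y) \<le> v x"
    using v_add_le[of x y] assms by simp
  show "v x \<le> v (x + y)"
    using v_diff_le[of "x + y" y] assms by simp
qed

lemma v_lim_unique:
  assumes "(\<lambda>n. v (X n - l)) \<longlonglongrightarrow> 0" and "(\<lambda>n. v (X n - m)) \<longlonglongrightarrow> 0"
  shows "l = m"
proof -
  have "(\<lambda>n. max (v (X n - l)) (v (X n - m))) \<longlonglongrightarrow> max 0 0"
    using assms by (rule tendsto_max)
  moreover have "v (l - m) \<le> max (v (X n - l)) (v (X n - m))" for n
    using v_diff_triangle_le[of l m "X n"] by (simp add: v_diff_commute)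
  ultimately have "v (l - m) \<le> max 0 0"
    by (intro tendsto_le[OF sequentially_bot _ tendsto_const]) auto
  then show ?thesis
    using v_nonneg[of "l - m"] by (metis eq_iff_diff_eq_0 max.idem order_antisym v_eq_0_iff)
qed

lemma v_lim_le:
  assumes "(\<lambda>n. v (X n - l)) \<longlonglongrightarrow> 0" and "\<forall>\<^sub>F n in sequentially. v (X n) \<le> B"
  shows "v l \<le> B"
proof (rule field_le_epsilon)
  fix e :: real assume "0 < e"
  then have "\<forall>\<^sub>F n in sequentially. v (X n - l) < e"
    using assms(1) by (simp add: order_tendsto_iff)
  then obtain n where n: "v (X n - l) < e" "v (X n) \<le> B"
    using eventually_happens'[OF sequentially_bot eventually_conj[OF _ assms(2)]] by blast
  have "v l \<le> max (v (X n)) (v (X n - l))"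
    using v_diff_le[of "X n" "X n - l"] by simp
  with n \<open>0 < e\<close> v_nonneg[of "X n"] show "v l \<le> B + e"
    by linarith
qed

lemma v_lim_add:
  assumes "(\<lambda>n. v (X n - l)) \<longlonglongrightarrow> 0" and "(\<lambda>n. v (Y n - m)) \<longlonglongrightarrow> 0"
  shows "(\<lambda>n. v (X n + Y n - (l + m))) \<longlonglongrightarrow> 0"
proof (rule real_tendsto_sandwich[OF _ _ tendsto_const])
  show "(\<lambda>n. max (v (X n - l)) (v (Y n - m))) \<longlonglongrightarrow> 0"
    using tendsto_max[OF assms] by simp
  have "v (X n + Y n - (l + m)) \<le> max (v (X n - l)) (v (Y n - m))" for n
    using v_add_le[of "X n - l" "Y n - m"] by (simp add: algebra_simps)
  then show "\<forall>\<^sub>F n in sequentially. v (X n + Y n - (l + m)) \<le> max (v (X n - l)) (v (Y n - m))"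
    by simp
qed simp

lemma v_lim_cmult:
  assumes "(\<lambda>n. v (X n - l)) \<longlonglongrightarrow> 0"
  shows "(\<lambda>n. v (c * X n - c * l)) \<longlonglongrightarrow> 0"
  using tendsto_mult_right_zero[OF assms, of "v c"]
  by (simp add: v_mult flip: right_diff_distrib)

lemma v_lim_close:
  assumes "(\<lambda>n. v (X n - l)) \<longlonglongrightarrow> 0" and "(\<lambda>n. B n) \<longlonglongrightarrow> 0"
    and "\<forall>\<^sub>F n in sequentially. v (Y n - X n) \<le> B n"
  shows "(\<lambda>n. v (Y n - l)) \<longlonglongrightarrow> 0"
proof (rule real_tendsto_sandwich[OF _ _ tendsto_const])
  show "(\<lambda>n. max (B n) (v (X n - l))) \<longlonglongrightarrow> 0"
    using tendsto_max[OF assms(2,1)] by simp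
  show "\<forall>\<^sub>F n in sequentially. v (Y n - l) \<le> max (B n) (v (X n - l))"
    using assms(3)
  proof eventually_elim
    case (elim n)
    then show ?case
      using v_diff_triangle_le[of "Y n" l "X n"] by linarith
  qed
qed simp

subsection \<open>Unordered sums\<close>

lemma has_vsum_iff:
  "has_vsum v f X l \<longleftrightarrow>
     (\<forall>e>0. \<exists>F. finite F \<and> F \<subseteq> X \<and> (\<forall>S. finite S \<and> F \<subseteq> S \<and> S \<subseteq> X \<longrightarrow> v (sum f S - l) < e))"
  unfolding has_vsum_def tendsto_iff
  by (simp add: eventually_finite_subsets_at_top)

text \<open>A finite set witnessing convergence lies in \<open>V d\<close> for large
  \<open>d\<close>, since each of its points does. This turns unordered sums into limits along
  boxes, where cancellation can be used.\<close>

lemma has_vsum_exhaust: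
  assumes "has_vsum v f X l"
    and "\<And>d. finite (V d)" "\<And>d. V d \<subseteq> X" "\<And>x. x \<in> X \<Longrightarrow> \<forall>\<^sub>F d in sequentially. x \<in> V d"
  shows "(\<lambda>d. v (sum f (V d) - l)) \<longlonglongrightarrow> 0"
  unfolding tendsto_iff
proof (intro allI impI)
  fix e :: real assume "0 < e"
  then obtain F where F: "finite F" "F \<subseteq> X"
      "\<And>S. finite S \<Longrightarrow> F \<subseteq> S \<Longrightarrow> S \<subseteq> X \<Longrightarrow> v (sum f S - l) < e"
    using assms(1) unfolding has_vsum_iff by meson
  have "\<forall>\<^sub>F d in sequentially. \<forall>x\<in>F. x \<in> V d"
    using F(1,2) assms(4) by (intro eventually_ball_finite) auto
  then show "\<forall>\<^sub>F d in sequentially. dist (v (sum f (V d) - l)) 0 < e"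
    by eventually_elim (use assms(2,3) F(3) in \<open>simp add: subset_iff\<close>)
qed

lemma has_vsum_unique:
  assumes "has_vsum v f X l" "has_vsum v f X m"
  shows "l = m"
proof -
  have "((\<lambda>S. max (v (sum f S - l)) (v (sum f S - m))) \<longlongrightarrow> max 0 0) (finite_subsets_at_top X)"
    using assms unfolding has_vsum_def by (rule tendsto_max)
  moreover have "v (l - m) \<le> max (v (sum f S - l)) (v (sum f S - m))" for S
    using v_diff_triangle_le[of l m "sum f S"] by (simp add: v_diff_commute)
  ultimately have "v (l - m) \<le> max 0 0"
    by (intro tendsto_le[OF finite_subsets_at_top_neq_bot _ tendsto_const]) auto
  then show ?thesis
    using v_nonneg[of "l - m"] by (metis eq_iff_diff_eq_0 max.idem order_antisym v_eq_0_iff)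
qed

lemma vsum_eqI: "has_vsum v f X l \<Longrightarrow> vsum v f X = l"
  unfolding vsum_def by (metis (no_types, lifting) has_vsum_unique the_equality)

lemma has_vsum_cong:
  assumes "\<And>x. x \<in> X \<Longrightarrow> f x = g x"
  shows "has_vsum v f X l \<longleftrightarrow> has_vsum v g X l"
proof -
  have "sum f S = sum g S" if "S \<subseteq> X" for S
    using assms that by (intro sum.cong) auto
  then show ?thesis
    unfolding has_vsum_def
    by (intro filterlim_cong refl eventually_finite_subsets_at_top_weakI) simp
qed

lemma has_vsum_cmult:
  assumes "has_vsum v f X l"
  shows "has_vsum v (\<lambda>x. c * f x) X (c * l)"
proof -
  have "v (sum (\<lambda>x. c * f x) S - c * l) = v c * v (sum f S - l)" for S
    by (simp add: v_mult flip: sum_distrib_left right_diff_distrib)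
  then show ?thesis
    using tendsto_mult_right_zero[of "\<lambda>S. v (sum f S - l)" _ "v c"] assms
    by (simp add: has_vsum_def)
qed

lemma has_vsum_add:
  assumes "has_vsum v f X l" "has_vsum v g X m"
  shows "has_vsum v (\<lambda>x. f x + g x) X (l + m)"
  unfolding has_vsum_def
proof (rule real_tendsto_sandwich[OF _ _ tendsto_const])
  show "((\<lambda>S. max (v (sum f S - l)) (v (sum g S - m))) \<longlongrightarrow> 0) (finite_subsets_at_top X)"
    using tendsto_max[OF assms[unfolded has_vsum_def]] by simp
  have "v (sum (\<lambda>x. f x + g x) S - (l + m)) \<le> max (v (sum f S - l)) (v (sum g S - m))" for S
    using v_add_le[of "sum f S - l" "sum g S - m"] by (simp add: algebra_simps sum.distrib)
  then show "\<forall>\<^sub>F S in finite_subsets_at_top X.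
      v (sum (\<lambda>x. f x + g x) S - (l + m)) \<le> max (v (sum f S - l)) (v (sum g S - m))"
    by simp
qed simp

lemma has_vsum_diff:
  assumes "has_vsum v f X l" "has_vsum v g X m"
  shows "has_vsum v (\<lambda>x. f x - g x) X (l - m)"
  using has_vsum_add[OF assms(1) has_vsum_cmult[OF assms(2), of "-1"]] by simp

lemma has_vsum_bound:
  assumes "has_vsum v f X l" "\<And>x. x \<in> X \<Longrightarrow> v (f x) \<le> B" "0 \<le> B"
  shows "v l \<le> B"
proof (rule field_le_epsilon)
  fix e :: real assume "0 < e"
  then obtain F where F: "finite F" "F \<subseteq> X" "v (sum f F - l) < e"
    using assms(1) unfolding has_vsum_iff by blast
  have "v (sum f F) \<le> B"
    using F(2) assms(2,3) by (intro v_sum_le) auto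
  moreover have "v l \<le> max (v (sum f F)) (v (sum f F - l))"
    using v_diff_le[of "sum f F" "sum f F - l"] by simp
  ultimately show "v l \<le> B + e"
    using F(3) \<open>0 < e\<close> assms(3) by linarith
qed

text \<open>In a complete ultrametric field this alone gives convergence of the unordered sum, so it
  takes the place of absolute summability.\<close>

definition vanishing :: "('i \<Rightarrow> 'c) \<Rightarrow> 'i set \<Rightarrow> bool" where
  "vanishing f X \<longleftrightarrow> (\<forall>e>0. finite {x \<in> X. e \<le> v (f x)})"

lemma vanishing_mono:
  assumes "vanishing f X" "0 \<le> C" "\<And>x. x \<in> X \<Longrightarrow> v (g x) \<le> C * v (f x)"
  shows "vanishing g X"
  unfolding vanishing_def
proof (intro allI impI)
  fix e :: real assume "0 < e"
  have "{x \<in> X. e \<le> v (g x)} \<subseteq> {x \<in> X. e / (C + 1) \<le> v (f x)}"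
  proof safe
    fix x assume "x \<in> X" "e \<le> v (g x)"
    then have "e \<le> C * v (f x)"
      using assms(3) by force
    also have "\<dots> \<le> (C + 1) * v (f x)"
      by (simp add: distrib_right)
    finally show "e / (C + 1) \<le> v (f x)"
      using assms(2) by (simp add: divide_le_eq mult.commute)
  qed
  moreover have "finite {x \<in> X. e / (C + 1) \<le> v (f x)}"
    using assms(1,2) \<open>0 < e\<close> unfolding vanishing_def by simp
  ultimately show "finite {x \<in> X. e \<le> v (g x)}"
    by (rule finite_subset)
qed

lemma vanishing_natI:
  fixes f :: "nat \<Rightarrow> 'c"
  assumes "B \<longlonglongrightarrow> 0" "\<forall>\<^sub>F n in sequentially. v (f n) \<le> B n"
  shows "vanishing f UNIV"
  unfolding vanishing_def
proof (intro allI impI)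
  fix e :: real assume "0 < e"
  then have "\<forall>\<^sub>F n in sequentially. B n < e"
    using assms(1) by (simp add: order_tendsto_iff)
  with assms(2) have "\<forall>\<^sub>F n in sequentially. v (f n) < e"
    by eventually_elim simp
  then obtain N where "\<And>n. n \<ge> N \<Longrightarrow> v (f n) < e"
    by (auto simp: eventually_sequentially)
  then have "{n \<in> UNIV. e \<le> v (f n)} \<subseteq> {..<N}"
    by (force simp: not_le)
  then show "finite {n \<in> UNIV. e \<le> v (f n)}"
    by (rule finite_subset) simp
qed

text \<open>A finite sum over points outside the level set \<open>F n\<close> is bounded by its
  largest term. So the sums over \<open>F n\<close> are Cauchy, and every larger finite sum stays
  near them.\<close>

lemma vanishing_has_vsum:
  assumes "v_complete v" "vanishing f X"
  obtains l where "has_vsum v f X l"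
proof -
  define F where "F n = {x \<in> X. 1 / Suc n \<le> v (f x)}" for n
  have F: "finite (F n)" "F n \<subseteq> X" for n
    using assms(2) unfolding vanishing_def F_def by auto
  have close: "v (sum f S - sum f (F n)) \<le> 1 / Suc n" if "finite S" "F n \<subseteq> S" "S \<subseteq> X" for S n
  proof -
    have "sum f S - sum f (F n) = sum f (S - F n)"
      using that by (simp add: sum_diff)
    then show ?thesis
      using that by (auto intro!: v_sum_le simp: F_def not_le intro: less_imp_le)
  qed
  have mono: "F m \<subseteq> F n" if "m \<le> n" for m n
  proof -
    have "1 / real (Suc n) \<le> 1 / real (Suc m)"
      using that by (simp add: frac_le)
    then show ?thesis
      unfolding F_def by force
  qed
  have "\<exists>N. \<forall>m\<ge>N. \<forall>n\<ge>N. v (sum f (F m) - sum f (F n)) < e" if e: "0 < e" for e :: real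
  proof -
    obtain N where N: "1 / Suc N < e"
      using e nat_approx_posE by blast
    have "v (sum f (F m) - sum f (F n)) < e" if "m \<ge> N" "n \<ge> N" for m n
    proof -
      have "v (sum f (F m) - sum f (F N)) \<le> 1 / Suc N" "v (sum f (F N) - sum f (F n)) \<le> 1 / Suc N"
        using close[of "F m" N] close[of "F n" N] F mono that
        by (simp_all add: v_diff_commute[of "sum f (F N)"])
      then show ?thesis
        using N v_diff_triangle_le[of "sum f (F m)" "sum f (F n)" "sum f (F N)"] by linarith
    qed
    then show ?thesis by blast
  qed
  then obtain l where l: "(\<lambda>n. v (sum f (F n) - l)) \<longlonglongrightarrow> 0"
    using assms(1) unfolding v_complete_def by meson
  have "has_vsum v f X l"
    unfolding has_vsum_iff
  proof (intro allI impI)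
    fix e :: real assume "0 < e"
    then have "\<forall>\<^sub>F n in sequentially. v (sum f (F n) - l) < e"
      using l by (simp add: order_tendsto_iff)
    moreover have "\<forall>\<^sub>F n in sequentially. 1 / Suc n < e"
      using LIMSEQ_inverse_real_of_nat \<open>0 < e\<close> by (simp add: order_tendsto_iff inverse_eq_divide)
    ultimately obtain n where n: "v (sum f (F n) - l) < e" "1 / Suc n < e"
      using eventually_happens'[OF sequentially_bot eventually_conj] by blast
    have "v (sum f S - l) < e" if "finite S" "F n \<subseteq> S" "S \<subseteq> X" for S
      using close[OF that] n v_diff_triangle_le[of "sum f S" l "sum f (F n)"] by linarith
    then show "\<exists>F. finite F \<and> F \<subseteq> X \<and> (\<forall>S. finite S \<and> F \<subseteq> S \<and> S \<subseteq> X \<longrightarrow> v (sum f S - l) < e)"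
      using F by (intro exI[of _ "F n"]) simp
  qed
  then show thesis by (rule that)
qed

lemma has_vsum_vsum:
  assumes "v_complete v" "vanishing f X"
  shows "has_vsum v f X (vsum v f X)"
  using vanishing_has_vsum[OF assms] vsum_eqI by metis

subsection \<open>Derivatives\<close>

lemma has_vderivI:
  assumes "0 < r"
    and "\<And>w. w \<noteq> z \<Longrightarrow> v (w - z) < r \<Longrightarrow> v ((f w - f z) / (w - z) - d) \<le> C * v (w - z)"
  shows "has_vderiv v f z d"
  unfolding has_vderiv_def tendsto_iff
proof (intro allI impI)
  fix e :: real assume "0 < e"
  \<comment> \<open>\<open>C\<close> may be zero or negative, so the radius is formed with
    \<open>\<bar>C\<bar> + 1\<close>.\<close>
  define s where "s = min r (e / (\<bar>C\<bar> + 1))"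
  have "0 < s"
    using assms(1) \<open>0 < e\<close> by (simp add: s_def)
  have "v ((f w - f z) / (w - z) - d) < e" if "w \<noteq> z" "v (w - z) < s" for w
  proof -
    have "v ((f w - f z) / (w - z) - d) \<le> C * v (w - z)"
      using assms(2) that by (simp add: s_def)
    also have "\<dots> \<le> (\<bar>C\<bar> + 1) * v (w - z)"
      by (intro mult_right_mono) auto
    also have "\<dots> < e"
      using that by (simp add: s_def pos_less_divide_eq mult.commute)
    finally show ?thesis .
  qed
  then have "\<forall>\<^sub>F w in principal {w. w \<noteq> z \<and> v (w - z) < s}.
      dist (v ((f w - f z) / (w - z) - d)) 0 < e"
    by (auto simp: eventually_principal)
  then show "\<forall>\<^sub>F w in v_at v z. dist (v ((f w - f z) / (w - z) - d)) 0 < e"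
    unfolding v_at_def using \<open>0 < s\<close>
    by (auto intro: filter_leD[OF INF_lower, of s])
qed

text \<open>The points \<open>z + inverse t ^ n\<close> approach \<open>z\<close> without meeting
  it, so the filter is proper and derivatives are unique.\<close>

lemma v_at_neq_bot:
  assumes "1 < v t"
  shows "v_at v z \<noteq> bot"
proof
  assume "v_at v z = bot"
  then have "eventually (\<lambda>_. False) (v_at v z)"
    by simp
  then have "\<exists>e\<in>{0<..}. eventually (\<lambda>_. False) (principal {w. w \<noteq> z \<and> v (w - z) < e})"
    unfolding v_at_def
  proof (subst (asm) eventually_INF_base)
    fix a b :: real assume "a \<in> {0<..}" "b \<in> {0<..}"
    then show "\<exists>x\<in>{0<..}. principal {w. w \<noteq> z \<and> v (w - z) < x} \<le>
        inf (principal {w. w \<noteq> z \<and> v (w - z) < a}) (principal {w. w \<noteq> z \<and> v (w - z) < b})"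
      by (intro bexI[of _ "min a b"]) auto
  qed auto
  then obtain e where e: "0 < e" "\<And>w. w \<noteq> z \<Longrightarrow> \<not> v (w - z) < e"
    by (auto simp: eventually_principal)
  have "inverse (v t) < 1"
    using assms by (simp add: inverse_less_1_iff)
  then obtain n where "inverse (v t) ^ n < e"
    using real_arch_pow_inv[OF e(1)] by blast
  then have "v (z + inverse t ^ n - z) < e"
    by (simp add: v_power v_inverse)
  moreover have "z + inverse t ^ n \<noteq> z"
    using assms by auto
  ultimately show False
    using e(2) by blast
qed

lemma vderiv_eqI:
  assumes "has_vderiv v f z d" "1 < v t"
  shows "vderiv v f z = d"
proof -
  have "d' = d" if "has_vderiv v f z d'" for d'
  proof -
    let ?D = "\<lambda>w. (f w - f z) / (w - z)"
    have "((\<lambda>w. max (v (?D w - d')) (v (?D w - d))) \<longlongrightarrow> max 0 0) (v_at v z)"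
      using that assms(1) unfolding has_vderiv_def by (rule tendsto_max)
    moreover have "v (d' - d) \<le> max (v (?D w - d')) (v (?D w - d))" for w
      using v_diff_triangle_le[of d' d "?D w"] by (simp add: v_diff_commute)
    ultimately have "v (d' - d) \<le> max 0 0"
      by (intro tendsto_le[OF v_at_neq_bot[OF assms(2)] _ tendsto_const]) auto
    then show ?thesis
      using v_nonneg[of "d' - d"] by (metis eq_iff_diff_eq_0 max.idem order_antisym v_eq_0_iff)
  qed
  then show ?thesis
    unfolding vderiv_def using assms(1) by (metis (no_types, lifting) the_equality)
qed

text \<open>The remainder has constant 1 for every \<open>n\<close>, because integers have absolute
  value at most 1. The induction multiplies by \<open>1 / (1 + s)\<close>.\<close>

lemma v_inverse_power_taylor:
  assumes "v s < 1"
  shows "v (inverse ((1 + s) ^ n) - 1 + of_nat n * s) \<le> v s ^ 2"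
proof -
  define r where "r = inverse (1 + s)"
  have s1: "v (1 + s) = 1"
    using v_add_eq_left[of s 1] assms by simp
  then have "1 + s \<noteq> 0"
    by (metis v_0 zero_neq_one)
  \<comment> \<open>The geometric series cut after two terms; substituting it makes the factor
    \<open>s^2\<close> of the new remainder visible.\<close>
  then have r: "r = 1 - s + s^2 * r"
    by (simp add: r_def field_simps power2_eq_square)
  have vr: "v r = 1"
    by (simp add: r_def v_inverse s1)
  have "v (r ^ n - 1 + of_nat n * s) \<le> v s ^ 2"
  proof (induction n)
    case (Suc n)
    have "r ^ Suc n - 1 + of_nat (Suc n) * s
        = r * (r ^ n - 1 + of_nat n * s) + (r * (1 - of_nat n * s) - 1 + of_nat (Suc n) * s)"
      by (simp add: algebra_simps)
    also have "r * (1 - of_nat n * s) - 1 + of_nat (Suc n) * s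
        = s^2 * (of_nat n + r * (1 - of_nat n * s))"
      by (subst r) (simp add: algebra_simps power2_eq_square)
    finally have eq: "r ^ Suc n - 1 + of_nat (Suc n) * s
        = r * (r ^ n - 1 + of_nat n * s) + s^2 * (of_nat n + r * (1 - of_nat n * s))" .
    have "v (of_nat n * s) \<le> 1"
      using mult_mono[OF v_of_nat_le_1[of n] less_imp_le[OF assms]] by (simp add: v_mult)
    then have "v (of_nat n + r * (1 - of_nat n * s)) \<le> 1"
      by (auto intro!: v_add_bound v_diff_bound v_of_nat_le_1 simp: v_mult vr)
    then have "v (s^2 * (of_nat n + r * (1 - of_nat n * s))) \<le> v s ^ 2"
      by (simp add: v_mult v_power mult_left_le)
    then show ?case
      unfolding eq using Suc.IH by (intro v_add_bound) (simp_all add: v_mult vr)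
  qed simp
  then show ?thesis
    by (simp add: r_def power_inverse)
qed

end

section \<open>The ring of polynomials over the finite field\<close>

text \<open>Reindexing by the permutation \<open>\<tau>\<close> leaves the sum of
  \<open>\<phi>\<close> unchanged, yet adds 1 for each element. No cardinality has to be
  computed.\<close>

lemma of_nat_card_eq_0_if_shift:
  fixes \<phi> :: "'x \<Rightarrow> 'c::field"
  assumes "finite S" "inj_on \<tau> S" "\<tau> ` S \<subseteq> S" "\<And>x. x \<in> S \<Longrightarrow> \<phi> (\<tau> x) = \<phi> x + 1"
  shows "of_nat (card S) = (0::'c)"
proof -
  have "sum \<phi> S = sum \<phi> (\<tau> ` S)"
    using endo_inj_surj[OF assms(1,3,2)] by simp
  also have "\<dots> = (\<Sum>x\<in>S. \<phi> x + 1)"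
    using assms(2,4) by (simp add: sum.reindex)
  finally show ?thesis
    by (simp add: sum.distrib)
qed

locale cinf =
  fixes v :: "'c::field \<Rightarrow> real" and q :: nat and \<theta> :: 'c
  assumes setting: "Cinf_setting v q \<theta>"

sublocale cinf \<subseteq> nonarch_field v
  by unfold_locales (use setting in \<open>simp add: Cinf_setting_def\<close>)

context cinf
begin

lemma complete: "v_complete v"
  and v_theta: "1 < v \<theta>"
  using setting by (simp_all add: Cinf_setting_def)

lemma theta_nonzero [simp]: "\<theta> \<noteq> 0"
  using v_theta by auto

lemma q_prime_power:
  obtains p e where "prime p" "0 < e" "q = p ^ e" "of_nat p = (0::'c)" "CHAR('c) = p"
proof -
  obtain p e where pe: "prime p" "0 < e" "q = p ^ e" "of_nat p = (0::'c)"
    using setting by (auto simp: Cinf_setting_def)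
  then have "CHAR('c) dvd p" "CHAR('c) \<noteq> 1"
    by (auto simp: of_nat_eq_0_iff_char_dvd)
  then have "CHAR('c) = p"
    using pe(1) by (metis prime_nat_iff)
  with pe that show thesis by blast
qed

lemma q_gt_1: "1 < q"
proof -
  obtain p e where "prime p" "0 < e" "q = p ^ e"
    using q_prime_power by metis
  then show ?thesis
    using one_less_power prime_gt_1_nat by blast
qed

section \<open>The field of constants\<close>

lemma Fq_0 [simp]: "0 \<in> Fq q" and Fq_1 [simp]: "1 \<in> Fq q"
  using q_gt_1 by (simp_all add: Fq_def)

lemma Fq_add: "x \<in> Fq q \<Longrightarrow> y \<in> Fq q \<Longrightarrow> x + y \<in> Fq q" for x y :: 'c
  by (rule q_prime_power) (auto simp: Fq_def freshmans_dream')

lemma Fq_mult: "x \<in> Fq q \<Longrightarrow> y \<in> Fq q \<Longrightarrow> x * y \<in> Fq q" for x y :: 'c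
  by (simp add: Fq_def power_mult_distrib)

lemma Fq_inverse: "x \<in> Fq q \<Longrightarrow> inverse x \<in> Fq q" for x :: 'c
  by (simp add: Fq_def power_inverse)

text \<open>\<open>- x\<close> is a sum of \<open>p - 1\<close> copies of \<open>x\<close>, so
  closure under addition suffices and odd and even \<open>q\<close> are treated alike.\<close>

lemma Fq_uminus:
  fixes x :: 'c
  assumes "x \<in> Fq q"
  shows "- x \<in> Fq q"
proof -
  obtain p where p: "prime p" "of_nat p = (0::'c)"
    using q_prime_power by metis
  have "of_nat n * x \<in> Fq q" for n
    using assms by (induction n) (auto simp: distrib_right intro: Fq_add)
  moreover have "of_nat (p - 1) * x = - x"
    using p prime_gt_0_nat[of p] by (simp add: of_nat_diff)
  ultimately show ?thesis by metis
qed

lemma finite_Fq: "finite (Fq q :: 'c set)"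
proof -
  have "coeff (monom (1::'c) q - monom 1 1) q \<noteq> 0"
    using q_gt_1 by simp
  then have "monom (1::'c) q - monom 1 1 \<noteq> 0"
    by (metis coeff_0)
  moreover have "Fq q = {x. poly (monom (1::'c) q - monom 1 1) x = 0}"
    by (auto simp: Fq_def poly_monom)
  ultimately show ?thesis
    using poly_roots_finite by metis
qed

lemma card_Fq: "of_nat (card (Fq q :: 'c set)) = (0::'c)"
  by (rule of_nat_card_eq_0_if_shift[of _ "\<lambda>x. x + 1" "\<lambda>x. x"])
    (auto simp: finite_Fq Fq_add inj_on_def)

text \<open>A nonzero element is a root of unity of order dividing \<open>q - 1\<close>.\<close>

lemma v_Fq:
  assumes "x \<in> Fq q" "x \<noteq> 0"
  shows "v x = 1"
proof -
  have "v x ^ q = v x"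
    using assms(1) by (simp add: Fq_def flip: v_power)
  then have "v x ^ (q - 1) = 1"
    using assms(2) q_gt_1 by (cases q) auto
  then show ?thesis
    using power_eq_imp_eq_base[of "v x" "q - 1" 1] q_gt_1 by simp
qed

lemma v_Fq_le: "x \<in> Fq q \<Longrightarrow> v x \<le> 1"
  using v_Fq by (cases "x = 0") auto

section \<open>Polynomials evaluated at \<theta>, and their truncations by degree\<close>

lemma Apoly_0 [simp]: "0 \<in> Apoly q" and Apoly_1 [simp]: "1 \<in> Apoly q"
  by (simp_all add: Apoly_def)

lemma Apoly_uminus: "a \<in> Apoly q \<Longrightarrow> - a \<in> Apoly q" for a :: "'c poly"
  by (simp add: Apoly_def Fq_uminus)

text \<open>In the Horner form \<open>c + \<theta> * poly a \<theta>\<close> with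
  \<open>a \<noteq> 0\<close> the second summand is strictly larger, since |c| <= 1 <
  |\<theta>|.\<close>

lemma v_poly:
  assumes "a \<in> Apoly q" "a \<noteq> 0"
  shows "v (poly a \<theta>) = v \<theta> ^ degree a"
  using assms
proof (induction a)
  case (pCons c a)
  have c: "c \<in> Fq q" and a: "a \<in> Apoly q"
    using pCons.prems(1) unfolding Apoly_def by (force dest: spec[of _ 0], auto dest: spec[of _ "Suc _"])
  show ?case
  proof (cases "a = 0")
    case True
    then show ?thesis
      using c pCons.hyps v_Fq by simp
  next
    case False
    have "v c < v \<theta> ^ Suc (degree a)"
      using v_Fq_le[OF c] v_theta one_less_power[of "v \<theta>" "Suc (degree a)"] by simp
    moreover have "v (\<theta> * poly a \<theta>) = v \<theta> ^ Suc (degree a)"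
      using pCons.IH[OF a False] by (simp add: v_mult)
    ultimately show ?thesis
      using False v_add_eq_left[of c "\<theta> * poly a \<theta>"] by (simp add: add.commute)
  qed
qed simp

lemma v_poly_ge:
  assumes "a \<in> Apoly q" "coeff a n \<noteq> 0"
  shows "v \<theta> ^ n \<le> v (poly a \<theta>)"
proof -
  have "a \<noteq> 0" "n \<le> degree a"
    using assms(2) by (auto intro: le_degree)
  then show ?thesis
    using v_poly[OF assms(1)] v_theta by (simp add: power_increasing)
qed

lemma poly_theta_eq_0_iff: "a \<in> Apoly q \<Longrightarrow> poly a \<theta> = 0 \<longleftrightarrow> a = 0"
  using v_poly[of a] v_theta by (metis poly_0 power_not_zero theta_nonzero v_0 v_eq_0_iff)

text \<open>Cutting by coefficients rather than by \<open>degree\<close> puts the zero polynomial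
  into every level, including \<open>Adeg 0\<close>.\<close>

definition Adeg :: "nat \<Rightarrow> 'c poly set" where
  "Adeg d = {a \<in> Apoly q. \<forall>i\<ge>d. coeff a i = 0}"

lemma Adeg_subset: "Adeg d \<subseteq> Apoly q"
  by (auto simp: Adeg_def)

lemma Adeg_mono: "d \<le> e \<Longrightarrow> Adeg d \<subseteq> Adeg e"
  by (auto simp: Adeg_def)

lemma Adeg_0 [simp]: "0 \<in> Adeg d"
  by (simp add: Adeg_def)

lemma finite_Adeg: "finite (Adeg d)"
proof -
  have "Adeg d \<subseteq> Poly ` {xs. set xs \<subseteq> Fq q \<and> length xs = d}"
  proof
    fix a assume a: "a \<in> Adeg d"
    have "a = Poly (map (coeff a) [0..<d])"
      using a by (intro poly_eqI) (auto simp: Adeg_def nth_default_def)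
    moreover have "map (coeff a) [0..<d] \<in> {xs. set xs \<subseteq> Fq q \<and> length xs = d}"
      using a by (auto simp: Adeg_def Apoly_def)
    ultimately show "a \<in> Poly ` {xs. set xs \<subseteq> Fq q \<and> length xs = d}"
      by blast
  qed
  then show ?thesis
    by (rule finite_subset) (intro finite_imageI finite_lists_length_eq finite_Fq)
qed

lemma eventually_Adeg:
  assumes "a \<in> Apoly q"
  shows "\<forall>\<^sub>F d in sequentially. a \<in> Adeg d"
proof -
  have "a \<in> Adeg d" if "d \<ge> Suc (degree a)" for d
    using assms that by (auto simp: Adeg_def coeff_eq_0)
  then show ?thesis
    by (auto simp: eventually_sequentially)
qed

lemma Adeg_add_const:
  assumes "1 \<le> d" "c \<in> Fq q" "a \<in> Adeg d"
  shows "a + [:c:] \<in> Adeg d"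
  using assms by (auto simp: Adeg_def Apoly_def coeff_pCons split: nat.splits intro: Fq_add)

text \<open>The equivalence, unlike closure alone, passes to complements, so
  \<open>Adeg D - Adeg d\<close> is also stable under adding constants.\<close>

lemma Adeg_add_const_iff:
  assumes "1 \<le> d" "c \<in> Fq q"
  shows "a + [:c:] \<in> Adeg d \<longleftrightarrow> a \<in> Adeg d"
proof
  assume "a + [:c:] \<in> Adeg d"
  then have "a + [:c:] + [:- c:] \<in> Adeg d"
    using Adeg_add_const[OF assms(1) Fq_uminus[OF assms(2)]] by blast
  then show "a \<in> Adeg d"
    by (simp add: add.assoc)
qed (rule Adeg_add_const[OF assms])

lemma Adeg_smult: "c \<in> Fq q \<Longrightarrow> a \<in> Adeg d \<Longrightarrow> smult c a \<in> Adeg d"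
  by (auto simp: Adeg_def Apoly_def intro: Fq_mult)

lemma v_poly_ge_notin_Adeg:
  assumes "a \<in> Apoly q" "a \<notin> Adeg d"
  shows "v \<theta> ^ d \<le> v (poly a \<theta>)"
proof -
  obtain i where "i \<ge> d" "coeff a i \<noteq> 0"
    using assms by (auto simp: Adeg_def)
  then show ?thesis
    using v_poly_ge[OF assms(1)] v_theta by (meson less_imp_le order_trans power_increasing)
qed

lemma v_poly_le_Adeg:
  assumes "a \<in> Adeg d"
  shows "v (poly a \<theta>) \<le> v \<theta> ^ d"
proof (cases "a = 0")
  case False
  have "degree a < d"
    using assms False by (metis (mono_tags, lifting) Adeg_def leading_coeff_0_iff leI mem_Collect_eq)
  then show ?thesis
    using v_poly[OF subsetD[OF Adeg_subset assms] False] v_theta by (simp add: power_increasing)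
qed (use v_theta in auto)

lemma poly_Adeg:
  assumes "a \<in> Adeg d"
  shows "poly a x = (\<Sum>i<d. coeff a i * x ^ i)"
proof -
  have "poly a x = (\<Sum>i\<le>degree a. coeff a i * x ^ i)"
    by (rule poly_altdef)
  also have "\<dots> = (\<Sum>i\<in>{..degree a} \<inter> {..<d}. coeff a i * x ^ i)"
    using assms by (intro sum.mono_neutral_right) (auto simp: Adeg_def)
  also have "\<dots> = (\<Sum>i<d. coeff a i * x ^ i)"
    by (intro sum.mono_neutral_left) (auto simp: coeff_eq_0)
  finally show ?thesis .
qed

lemma card_Adeg:
  assumes "1 \<le> d"
  shows "of_nat (card (Adeg d)) = (0::'c)"
  by (rule of_nat_card_eq_0_if_shift[of _ "\<lambda>a. a + [:1:]" "\<lambda>a. coeff a 0"])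
    (use assms in \<open>auto simp: finite_Adeg Adeg_add_const inj_on_def\<close>)

text \<open>The minus sign is the order \<open>q - 1\<close> of the multiplicative group of the finite field, read in
  characteristic \<open>p\<close>.\<close>

lemma sum_Adeg_monic:
  fixes g :: "'c poly \<Rightarrow> 'c"
  assumes "\<And>c a. c \<in> Fq q \<Longrightarrow> c \<noteq> 0 \<Longrightarrow> g (smult c a) = g a"
  shows "sum g (Adeg d - {0}) = - sum g (Adeg d \<inter> Amonic q)"
proof -
  let ?h = "\<lambda>(c, a). smult c a :: 'c poly"
  have "bij_betw ?h ((Fq q - {0}) \<times> (Adeg d \<inter> Amonic q)) (Adeg d - {0})"
    unfolding bij_betw_def
  proof
    show "inj_on ?h ((Fq q - {0}) \<times> (Adeg d \<inter> Amonic q))"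
    proof (rule inj_onI)
      fix x y assume *: "x \<in> (Fq q - {0}) \<times> (Adeg d \<inter> Amonic q)"
        "y \<in> (Fq q - {0}) \<times> (Adeg d \<inter> Amonic q)" "?h x = ?h y"
      then have "lead_coeff (smult (fst x) (snd x)) = lead_coeff (smult (fst y) (snd y))"
        by (simp add: case_prod_unfold)
      then have "fst x = fst y"
        using *(1,2) unfolding lead_coeff_smult by (auto simp: Amonic_def)
      moreover from this have "snd x = snd y"
        using arg_cong[OF *(3), of "smult (inverse (fst x))"] *(1,2)
        by (auto simp: case_prod_unfold)
      ultimately show "x = y"
        by (simp add: prod_eq_iff)
    qed
    have "a \<in> ?h ` ((Fq q - {0}) \<times> (Adeg d \<inter> Amonic q))" if "a \<in> Adeg d" "a \<noteq> 0" for a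
    proof -
      have c: "lead_coeff a \<in> Fq q" "lead_coeff a \<noteq> 0"
        using that by (auto simp: Adeg_def Apoly_def)
      have "smult (inverse (lead_coeff a)) a \<in> Adeg d \<inter> Amonic q"
        using c that Adeg_smult[OF Fq_inverse[OF c(1)] that(1)] Adeg_subset
        by (auto simp: Amonic_def)
      moreover have "a = ?h (lead_coeff a, smult (inverse (lead_coeff a)) a)"
        using c by simp
      ultimately show ?thesis
        using c by blast
    qed
    then show "?h ` ((Fq q - {0}) \<times> (Adeg d \<inter> Amonic q)) = Adeg d - {0}"
      by (auto simp: Adeg_smult Amonic_def)
  qed
  then have "sum g (Adeg d - {0}) = (\<Sum>x\<in>(Fq q - {0}) \<times> (Adeg d \<inter> Amonic q). g (?h x))"
    by (rule sum.reindex_bij_betw[symmetric])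
  also have "\<dots> = (\<Sum>c\<in>Fq q - {0}. \<Sum>a\<in>Adeg d \<inter> Amonic q. g (smult c a))"
    by (simp only: sum.cartesian_product case_prod_unfold)
  also have "\<dots> = (\<Sum>c\<in>Fq q - {0::'c}. sum g (Adeg d \<inter> Amonic q))"
    by (intro sum.cong refl) (simp add: assms)
  also have "\<dots> = - sum g (Adeg d \<inter> Amonic q)"
    by (simp only: sum_diff1[OF finite_Fq]) (simp add: card_Fq)
  finally show ?thesis .
qed

section \<open>Cancellation along lines over the finite field\<close>

lemma line_sum_bound:
  fixes x w :: 'c
  assumes "0 < m" "\<And>c. c \<in> Fq q \<Longrightarrow> m \<le> v (x + c * w)"
  shows "v (\<Sum>c\<in>Fq q. inverse (x + c * w)) \<le> v w / m ^ 2"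
proof -
  have nz: "x + c * w \<noteq> 0" if "c \<in> Fq q" for c
    using assms that by fastforce
  have x: "x \<noteq> 0" "m \<le> v x"
    using nz[OF Fq_0] assms(2)[OF Fq_0] by auto
  \<comment> \<open>The constant \<open>inverse x\<close> is subtracted once per field element, in
    total a multiple by zero in characteristic \<open>p\<close>.\<close>
  have "(\<Sum>c\<in>Fq q. inverse (x + c * w)) = (\<Sum>c\<in>Fq q. inverse (x + c * w) - inverse x)"
    by (simp add: sum_subtractf card_Fq)
  also have "v \<dots> \<le> v w / m ^ 2"
  proof (rule v_sum_le)
    fix c :: 'c assume c: "c \<in> Fq q"
    have "inverse (x + c * w) - inverse x = - (c * w) / (x * (x + c * w))"
      using nz[OF c] x(1) by (simp add: field_simps)
    then have "v (inverse (x + c * w) - inverse x) = v c * v w / (v x * v (x + c * w))"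
      by (simp add: v_divide v_mult)
    also have "\<dots> \<le> v w / m ^ 2"
      unfolding power2_eq_square
      using v_Fq_le[OF c] x(2) assms(1) assms(2)[OF c]
      by (intro frac_le mult_mono) (auto simp: mult_left_le_one_le)
    finally show "v (inverse (x + c * w) - inverse x) \<le> v w / m ^ 2" .
  qed (use assms in simp)
  finally show ?thesis .
qed

text \<open>\<open>\<tau>\<close> is an action of the additive group of the finite field on \<open>X\<close>, and the coordinate \<open>r\<close>
  singles out the point \<open>r = 0\<close> of each orbit.\<close>

lemma orbit_sum_bound:
  fixes X :: "'x set" and \<tau> :: "'c \<Rightarrow> 'x \<Rightarrow> 'x" and lam s r :: "'x \<Rightarrow> 'c"
  assumes X: "\<And>c x. c \<in> Fq q \<Longrightarrow> x \<in> X \<Longrightarrow> \<tau> c x \<in> X"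
    and \<tau>: "\<And>c c' x. \<tau> c (\<tau> c' x) = \<tau> (c + c') x" "\<And>x. \<tau> 0 x = x"
    and r: "\<And>x. x \<in> X \<Longrightarrow> r x \<in> Fq q" "\<And>c x. r (\<tau> c x) = r x + c"
    and lam: "\<And>c x. lam (\<tau> c x) = lam x + c * w" "\<And>x. x \<in> X \<Longrightarrow> m \<le> v (lam x)" "0 < m"
    and s: "\<And>c x. s (\<tau> c x) = s x" "\<And>x. x \<in> X \<Longrightarrow> v (s x) \<le> 1"
  shows "v (\<Sum>x\<in>X. inverse (lam x) * s x) \<le> v w / m ^ 2"
proof -
  define X0 where "X0 = {x \<in> X. r x = 0}"
  let ?h = "\<lambda>(x, c). \<tau> c x"
  \<comment> \<open>Each point comes from exactly one point of the slice \<open>X0\<close>: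
    \<open>r\<close> reads off the translation, and undoing it leads back to the slice.\<close>
  have "bij_betw ?h (X0 \<times> Fq q) X"
    unfolding bij_betw_def
  proof
    show "inj_on ?h (X0 \<times> Fq q)"
    proof (rule inj_onI, clarify)
      fix x c x' c'
      assume *: "x \<in> X0" "x' \<in> X0" "\<tau> c x = \<tau> c' x'"
      then have "c = c'"
        using r(2)[of c x] r(2)[of c' x'] by (simp add: X0_def)
      moreover have "x = \<tau> (- c) (\<tau> c x)" "x' = \<tau> (- c) (\<tau> c x')"
        by (simp_all add: \<tau>)
      ultimately show "x = x' \<and> c = c'"
        using *(3) by simp
    qed
    have "x \<in> ?h ` (X0 \<times> Fq q)" if "x \<in> X" for x
    proof -
      have "\<tau> (- r x) x \<in> X0"
        using that by (simp add: X0_def X r Fq_uminus)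
      moreover have "x = ?h (\<tau> (- r x) x, r x)"
        by (simp add: \<tau>)
      ultimately show ?thesis
        using r(1)[OF that] by blast
    qed
    then show "?h ` (X0 \<times> Fq q) = X"
      by (auto simp: X0_def X)
  qed
  then have "(\<Sum>x\<in>X. inverse (lam x) * s x) = (\<Sum>y\<in>X0 \<times> Fq q. inverse (lam (?h y)) * s (?h y))"
    by (rule sum.reindex_bij_betw[symmetric])
  also have "\<dots> = (\<Sum>x\<in>X0. (\<Sum>c\<in>Fq q. inverse (lam x + c * w)) * s x)"
    by (simp add: sum.cartesian_product case_prod_unfold lam(1) s(1) sum_distrib_right)
  also have "v \<dots> \<le> v w / m ^ 2"
  proof (rule v_sum_le)
    fix x assume "x \<in> X0"
    then have x: "x \<in> X" by (simp add: X0_def)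
    have "v (\<Sum>c\<in>Fq q. inverse (lam x + c * w)) \<le> v w / m ^ 2"
      using lam X x by (intro line_sum_bound) (auto simp flip: lam(1))
    then show "v ((\<Sum>c\<in>Fq q. inverse (lam x + c * w)) * s x) \<le> v w / m ^ 2"
      unfolding v_mult using s(2)[OF x] by (meson mult_left_le order_trans v_nonneg)
  qed simp
  finally show ?thesis .
qed

end

section \<open>Eisenstein series at a point of the upper half plane\<close>

text \<open>A point outside the closure of the rational functions has positive distance
  \<open>e\<close> from them. Scaling by \<open>a\<close> gives |az + b| >= e|a|. For
  \<open>b\<close>, either |az| < |b| and then |az + b| = |b|, or |b| <= |a||z|.\<close>

lemma (in cinf) Omega_lower_bound:
  assumes "z \<in> Omega v q \<theta>"
  obtains C where "0 < C"
    "\<And>a b. a \<in> Apoly q \<Longrightarrow> b \<in> Apoly q \<Longrightarrow>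
       C * max (v (poly a \<theta>)) (v (poly b \<theta>)) \<le> v (poly a \<theta> * z + poly b \<theta>)"
proof -
  have "\<exists>e>0. \<forall>x\<in>Kfrac q \<theta>. e \<le> v (x - z)"
  proof (rule ccontr)
    assume "\<not> ?thesis"
    then have "\<exists>x. x \<in> Kfrac q \<theta> \<and> v (x - z) < 1 / Suc n" for n
      by (metis not_le of_nat_0_less_iff zero_less_Suc zero_less_divide_1_iff)
    then obtain X where X: "\<And>n. X n \<in> Kfrac q \<theta>" "\<And>n. v (X n - z) < 1 / Suc n"
      by metis
    have "(\<lambda>n. v (X n - z)) \<longlonglongrightarrow> 0"
    proof (rule real_tendsto_sandwich[OF _ _ tendsto_const])
      show "(\<lambda>n. 1 / real (Suc n)) \<longlonglongrightarrow> 0"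
        using LIMSEQ_inverse_real_of_nat by (simp add: inverse_eq_divide)
    qed (use X(2) in \<open>auto intro!: always_eventually less_imp_le\<close>)
    then show False
      using assms X(1) by (auto simp: Omega_def K_inf_def)
  qed
  then obtain e where e: "0 < e" "\<And>x. x \<in> Kfrac q \<theta> \<Longrightarrow> e \<le> v (x - z)"
    by blast
  have "poly 0 \<theta> / poly 1 \<theta> \<in> Kfrac q \<theta>"
    unfolding Kfrac_def using Apoly_0 Apoly_1 one_neq_zero by blast
  then have z: "e \<le> v z"
    using e(2) by fastforce
  \<comment> \<open>\<open>C \<le> 1\<close> serves \<open>a = 0\<close> and the case |az| < |b|,
    \<open>C \<le> e\<close> the bound by |a|, and \<open>C * v z \<le> e\<close> the case |b| <=
    |az|.\<close>
  define C where "C = min (min 1 e) (e / v z)"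
  have "0 < v z"
    using z e(1) by linarith
  then have C: "0 < C" "C \<le> 1" "C \<le> e" "C * v z \<le> e"
    using e(1) by (auto simp: C_def min_mult_distrib_right min_le_iff_disj)
  have "C * max (v (poly a \<theta>)) (v (poly b \<theta>)) \<le> v (poly a \<theta> * z + poly b \<theta>)"
    if ab: "a \<in> Apoly q" "b \<in> Apoly q" for a b
  proof (cases "a = 0")
    case True
    then show ?thesis
      using C mult_right_mono[OF C(2), of "v (poly b \<theta>)"] by simp
  next
    case False
    let ?a = "poly a \<theta>" and ?b = "poly b \<theta>"
    have nz: "?a \<noteq> 0"
      using False ab(1) by (simp add: poly_theta_eq_0_iff)
    have "poly (- b) \<theta> / ?a \<in> Kfrac q \<theta>"
      unfolding Kfrac_def using ab False Apoly_uminus by blast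
    from e(2)[OF this] have "v ?a * e \<le> v ?a * v (- ?b / ?a - z)"
      by (intro mult_left_mono) simp_all
    also have "\<dots> = v (?a * z + ?b)"
    proof -
      have "?a * (- ?b / ?a - z) = - (?a * z + ?b)"
        using nz by (simp add: right_diff_distrib)
      then show ?thesis
        by (simp only: v_minus flip: v_mult)
    qed
    finally have a: "e * v ?a \<le> v (?a * z + ?b)"
      by (simp add: mult.commute)
    have "C * v ?a \<le> v (?a * z + ?b)"
      using a mult_right_mono[OF C(3), of "v ?a"] by simp
    moreover have "C * v ?b \<le> v (?a * z + ?b)"
    proof (cases "v (?a * z) < v ?b")
      case True
      then have "v (?a * z + ?b) = v ?b"
        using v_add_eq_left[OF True] by (simp add: add.commute)
      then show ?thesis
        using mult_right_mono[OF C(2), of "v ?b"] by simp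
    next
      case False
      then have "C * v ?b \<le> C * (v ?a * v z)"
        using C(1) by (simp add: v_mult)
      also have "\<dots> = C * v z * v ?a"
        by simp
      also have "\<dots> \<le> e * v ?a"
        using C(4) by (intro mult_right_mono) simp_all
      finally show ?thesis
        using a by simp
    qed
    ultimately show ?thesis
      by (simp add: max_def)
  qed
  with C(1) show thesis
    by (rule that)
qed

text \<open>The position of \<open>z\<close> relative to the rational functions enters only through
  the constant \<open>C\<close>, fixed here together with \<open>z\<close>.\<close>

locale cinf_point = cinf v q \<theta>
  for v :: "'c::field \<Rightarrow> real" and q \<theta> +
  fixes z :: 'c and C :: real
  assumes C_pos: "0 < C"
    and lower_bound: "\<And>a b. a \<in> Apoly q \<Longrightarrow> b \<in> Apoly q \<Longrightarrow>
      C * max (v (poly a \<theta>)) (v (poly b \<theta>)) \<le> v (poly a \<theta> * z + poly b \<theta>)"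
begin

section \<open>The lattice, its finite boxes and lower bounds\<close>

abbreviation lam :: "'c poly \<times> 'c poly \<Rightarrow> 'c" where
  "lam x \<equiv> poly (fst x) \<theta> * z + poly (snd x) \<theta>"

abbreviation lat :: "('c poly \<times> 'c poly) set" where
  "lat \<equiv> Apoly q \<times> Apoly q - {(0, 0)}"

abbreviation box :: "nat \<Rightarrow> ('c poly \<times> 'c poly) set" where
  "box d \<equiv> Adeg d \<times> Adeg d - {(0, 0)}"

lemma box: "finite (box d)" "box d \<subseteq> lat"
  using Adeg_subset by (auto simp: finite_Adeg)

lemma eventually_box: "x \<in> lat \<Longrightarrow> \<forall>\<^sub>F d in sequentially. x \<in> box d"
  using eventually_conj[OF eventually_Adeg[of "fst x"] eventually_Adeg[of "snd x"]]
  by (auto elim!: eventually_mono)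

lemma box_diff:
  assumes "d \<le> D"
  shows "box D - box d = Adeg D \<times> Adeg D - Adeg d \<times> Adeg d"
    and "box d \<subseteq> box D"
  using Adeg_mono[OF assms] by auto

lemma v_sel_le:
  assumes "x \<in> Apoly q \<times> Apoly q" "sel \<in> {fst, snd}"
  shows "C * v (poly (sel x) \<theta>) \<le> v (lam x)"
proof -
  have "C * v (poly (sel x) \<theta>) \<le> C * max (v (poly (fst x) \<theta>)) (v (poly (snd x) \<theta>))"
    using assms(2) C_pos by (intro mult_left_mono) auto
  then show ?thesis
    using lower_bound[of "fst x" "snd x"] assms(1) by (auto simp: mem_Times_iff)
qed

lemma lam_ge_outside:
  assumes "x \<in> Apoly q \<times> Apoly q" "x \<notin> Adeg d \<times> Adeg d"
  shows "C * v \<theta> ^ d \<le> v (lam x)"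
proof -
  obtain sel where sel: "sel \<in> {fst, snd}" "sel x \<in> Apoly q" "sel x \<notin> Adeg d"
    using assms by (auto simp: mem_Times_iff)
  then have "C * v \<theta> ^ d \<le> C * v (poly (sel x) \<theta>)"
    using v_poly_ge_notin_Adeg C_pos by simp
  then show ?thesis
    using v_sel_le[OF assms(1) sel(1)] by simp
qed

lemma lam_ge_coeff:
  assumes "x \<in> Apoly q \<times> Apoly q" "sel \<in> {fst, snd}" "coeff (sel x) n \<noteq> 0"
  shows "C * v \<theta> ^ n \<le> v (lam x)"
proof -
  have "C * v \<theta> ^ n \<le> C * v (poly (sel x) \<theta>)"
    using v_poly_ge[OF _ assms(3)] assms(1,2) C_pos by (auto simp: mem_Times_iff)
  then show ?thesis
    using v_sel_le[OF assms(1,2)] by simp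
qed

lemma lam_ge:
  assumes "x \<in> lat"
  shows "C \<le> v (lam x)"
proof -
  have "Adeg 0 = {0}"
    by (auto simp: Adeg_def poly_eq_iff)
  then show ?thesis
    using lam_ge_outside[of x 0] assms by auto
qed

lemma lam_nonzero: "x \<in> lat \<Longrightarrow> lam x \<noteq> 0"
  using lam_ge[of x] C_pos by (metis not_less v_0)

lemma inverse_lam_power_mult:
  assumes "x \<in> lat" "1 \<le> k"
  shows "inverse (lam x ^ k) * lam x = inverse (lam x ^ (k - 1))"
  using lam_nonzero[OF assms(1)] assms(2) by (cases k) auto

text \<open>Outside a large box \<open>lam x\<close> is large, and the boxes are finite.\<close>

lemma vanishing_inverse_lam_power:
  assumes "1 \<le> k"
  shows "vanishing (\<lambda>x. inverse (lam x ^ k)) lat"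
  unfolding vanishing_def
proof (intro allI impI)
  fix e :: real assume "0 < e"
  \<comment> \<open>The maximum with 1 forces |\<open>lam x\<close>| > 1 off the box, so that its
    \<open>k\<close>-th power is at least as large as itself.\<close>
  obtain d where "max 1 (1 / e) / C < v \<theta> ^ d"
    using real_arch_pow[OF v_theta] by blast
  then have d: "1 < C * v \<theta> ^ d" "1 / e < C * v \<theta> ^ d"
    using C_pos by (simp_all add: pos_divide_less_eq mult.commute)
  have "x \<in> box d" if x: "x \<in> lat" and le: "e \<le> v (inverse (lam x ^ k))" for x
  proof (rule ccontr)
    assume "x \<notin> box d"
    then have l: "C * v \<theta> ^ d \<le> v (lam x)"
      using x lam_ge_outside[of x d] by auto
    have "v (lam x) \<le> v (lam x) ^ k"
      using l d assms by (intro self_le_power) auto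
    then have "1 / e < v (lam x) ^ k"
      using l d by linarith
    then have "inverse (v (lam x) ^ k) < e"
      using \<open>0 < e\<close> by (metis inverse_eq_divide inverse_inverse_eq inverse_less_imp_less
          less_imp_inverse_less positive_imp_inverse_positive)
    then show False
      using le by (simp add: v_inverse v_power)
  qed
  then show "finite {x \<in> lat. e \<le> v (inverse (lam x ^ k))}"
    by (intro finite_subset[OF _ box(1)[of d]]) blast
qed

subsection \<open>Evaluation at \<open>\<theta>\<close>\<close>

text \<open>Box and power series are cut at the same level \<open>d\<close>. Inside the box
  \<open>sel x\<close> has degree below \<open>d\<close>, so the cut series already gives its value
  at \<theta>. The partial sums thus differ from the box sums only by tails, which
  \<open>tail\<close> makes small uniformly in \<open>n\<close>.\<close>

lemma ev_eq_limit:
  fixes f :: "'c poly \<times> 'c poly \<Rightarrow> 'c"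
  assumes sel: "sel \<in> {fst, snd}" and f: "vanishing f lat"
    and tail: "\<And>d D n. 1 \<le> d \<Longrightarrow> d \<le> D \<Longrightarrow>
      v (\<theta> ^ n * (\<Sum>x\<in>box D - box d. f x * coeff (sel x) n)) \<le> B / v \<theta> ^ d"
    and lim: "(\<lambda>d. v ((\<Sum>x\<in>box d. f x * poly (sel x) \<theta>) - L)) \<longlonglongrightarrow> 0"
  shows "vsum v (\<lambda>n. vsum v (\<lambda>x. f x * coeff (sel x) n) lat * \<theta> ^ n) UNIV = L"
proof -
  define S where "S n d = (\<Sum>x\<in>box d. f x * coeff (sel x) n)" for n d
  have coeff_le: "v (coeff (sel x) n) \<le> 1" if "x \<in> lat" for x n
    using that sel by (intro v_Fq_le) (auto simp: Apoly_def)
  define c where "c n = vsum v (\<lambda>x. f x * coeff (sel x) n) lat" for n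
  have c: "has_vsum v (\<lambda>x. f x * coeff (sel x) n) lat (c n)" for n
  proof -
    have "vanishing (\<lambda>x. f x * coeff (sel x) n) lat"
      using coeff_le by (intro vanishing_mono[OF f, of 1]) (simp_all add: v_mult mult_left_le)
    then show ?thesis
      unfolding c_def by (rule has_vsum_vsum[OF complete])
  qed
  have S_tail: "v (\<theta> ^ n * (c n - S n d)) \<le> B / v \<theta> ^ d" if "1 \<le> d" for n d
  proof (rule v_lim_le)
    have "(\<lambda>D. v (S n D - c n)) \<longlonglongrightarrow> 0"
      unfolding S_def by (rule has_vsum_exhaust[OF c box eventually_box])
    from tendsto_mult_right_zero[OF this, of "v (\<theta> ^ n)"]
    show "(\<lambda>D. v (\<theta> ^ n * (S n D - S n d) - \<theta> ^ n * (c n - S n d))) \<longlonglongrightarrow> 0"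
      by (simp flip: v_mult right_diff_distrib)
    have "v (\<theta> ^ n * (S n D - S n d)) \<le> B / v \<theta> ^ d" if "d \<le> D" for D
    proof -
      have "S n D - S n d = (\<Sum>x\<in>box D - box d. f x * coeff (sel x) n)"
        unfolding S_def by (rule sum_diff[OF box(1) box_diff(2)[OF that], symmetric])
      then show ?thesis
        using tail[OF \<open>1 \<le> d\<close> that, of n] by simp
    qed
    then show "\<forall>\<^sub>F D in sequentially. v (\<theta> ^ n * (S n D - S n d)) \<le> B / v \<theta> ^ d"
      by (auto simp: eventually_sequentially)
  qed
  have B: "(\<lambda>d. B / v \<theta> ^ d) \<longlonglongrightarrow> 0"
    using v_theta by (rule LIMSEQ_divide_realpow_zero)
  \<comment> \<open>In the box of level \<open>n\<close> all degrees are below \<open>n\<close>, so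
    the whole coefficient \<open>c n\<close> is a tail. Hence the terms of the power series tend to
    zero.\<close>
  have "S n n = 0" for n
    unfolding S_def using sel by (intro sum.neutral) (auto simp: Adeg_def)
  then have "v (c n * \<theta> ^ n) \<le> B / v \<theta> ^ n" if "1 \<le> n" for n
    using S_tail[OF that, of n] by (simp add: mult.commute)
  then have "vanishing (\<lambda>n. c n * \<theta> ^ n) UNIV"
    by (intro vanishing_natI[OF B]) (auto simp: eventually_sequentially)
  then obtain l where l: "has_vsum v (\<lambda>n. c n * \<theta> ^ n) UNIV l"
    by (rule vanishing_has_vsum[OF complete])
  have partial: "(\<lambda>d. v ((\<Sum>n<d. c n * \<theta> ^ n) - l)) \<longlonglongrightarrow> 0"
    by (rule has_vsum_exhaust[OF l]) (auto intro: eventually_gt_at_top)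
  have S_sum: "(\<Sum>n<d. S n d * \<theta> ^ n) = (\<Sum>x\<in>box d. f x * poly (sel x) \<theta>)" for d
  proof -
    have "(\<Sum>n<d. S n d * \<theta> ^ n) = (\<Sum>x\<in>box d. \<Sum>n<d. f x * coeff (sel x) n * \<theta> ^ n)"
      unfolding S_def sum_distrib_right by (rule sum.swap)
    also have "\<dots> = (\<Sum>x\<in>box d. f x * poly (sel x) \<theta>)"
    proof (rule sum.cong)
      fix x assume "x \<in> box d"
      then have "sel x \<in> Adeg d"
        using sel by auto
      then show "(\<Sum>n<d. f x * coeff (sel x) n * \<theta> ^ n) = f x * poly (sel x) \<theta>"
        by (simp add: poly_Adeg sum_distrib_left mult.assoc)
    qed simp
    finally show ?thesis .
  qed
  have "(\<lambda>d. v ((\<Sum>n<d. c n * \<theta> ^ n) - L)) \<longlonglongrightarrow> 0"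
  proof (rule v_lim_close[OF lim B])
    have "v ((\<Sum>n<d. c n * \<theta> ^ n) - (\<Sum>x\<in>box d. f x * poly (sel x) \<theta>)) \<le> B / v \<theta> ^ d"
      if "1 \<le> d" for d
    proof -
      have "(\<Sum>n<d. c n * \<theta> ^ n) - (\<Sum>x\<in>box d. f x * poly (sel x) \<theta>)
          = (\<Sum>n<d. \<theta> ^ n * (c n - S n d))"
        unfolding S_sum[symmetric] by (simp add: sum_subtractf algebra_simps)
      also have "v \<dots> \<le> B / v \<theta> ^ d"
        using S_tail[OF that] order_trans[OF v_nonneg S_tail[OF that]] by (intro v_sum_le)
      finally show ?thesis .
    qed
    then show "\<forall>\<^sub>F d in sequentially.
        v ((\<Sum>n<d. c n * \<theta> ^ n) - (\<Sum>x\<in>box d. f x * poly (sel x) \<theta>)) \<le> B / v \<theta> ^ d"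
      by (auto simp: eventually_sequentially)
  qed
  with partial have "l = L"
    by (rule v_lim_unique)
  then show ?thesis
    using vsum_eqI[OF l] by (simp only: c_def)
qed

text \<open>Two factors of \<open>y\<close> suffice: one compensates |\<theta>|^n, the other
  supplies the decay in \<open>d\<close>. Further factors do no harm, since the maximum is at least
  1.\<close>

lemma power_quotient_bound:
  assumes "2 \<le> k" "C * max (v \<theta> ^ d) (v \<theta> ^ n) \<le> y"
  shows "v \<theta> ^ n / y ^ k \<le> inverse (C ^ k) / v \<theta> ^ d"
proof -
  define M where "M = max (v \<theta> ^ d) (v \<theta> ^ n)"
  have M: "v \<theta> ^ d \<le> M" "v \<theta> ^ n \<le> M" "1 \<le> M"
    using v_theta by (auto simp: M_def le_max_iff_disj)
  have pos: "0 < v \<theta> ^ d" "0 < C ^ k" "0 < M"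
    using C_pos M(3) by auto
  have "v \<theta> ^ d * v \<theta> ^ n \<le> M * M"
    using M by (intro mult_mono) auto
  also have "\<dots> \<le> M ^ k"
    using M(3) power_increasing[OF assms(1), of M] by (simp add: power2_eq_square)
  finally have "C ^ k * (v \<theta> ^ d * v \<theta> ^ n) \<le> (C * M) ^ k"
    using C_pos by (simp add: power_mult_distrib)
  also have "\<dots> \<le> y ^ k"
    using assms(2) C_pos pos by (intro power_mono) (auto simp: M_def)
  finally have "C ^ k * (v \<theta> ^ d * v \<theta> ^ n) \<le> y ^ k" .
  moreover have "0 < y ^ k"
    using assms(2) C_pos pos by (intro zero_less_power) (smt (verit) M_def mult_pos_pos)
  ultimately show ?thesis
    using pos by (simp add: field_simps)
qed

text \<open>Each term is small by itself. If its \<open>n\<close>-th coefficient is nonzero, then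
  \<open>lam x\<close> is bounded below through the degree of \<open>sel x\<close> as well as
  through the position outside the small box.\<close>

lemma tail_bound_weight_ge_2:
  assumes "2 \<le> k" "sel \<in> {fst, snd}" "d \<le> D"
  shows "v (\<theta> ^ n * (\<Sum>x\<in>box D - box d. inverse (lam x ^ k) * coeff (sel x) n))
    \<le> inverse (C ^ k) / v \<theta> ^ d"
  unfolding sum_distrib_left
proof (rule v_sum_le)
  fix x assume "x \<in> box D - box d"
  then have x: "x \<in> Apoly q \<times> Apoly q" "x \<notin> Adeg d \<times> Adeg d"
    using box_diff[OF assms(3)] Adeg_subset by auto
  show "v (\<theta> ^ n * (inverse (lam x ^ k) * coeff (sel x) n)) \<le> inverse (C ^ k) / v \<theta> ^ d"
  proof (cases "coeff (sel x) n = 0")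
    case False
    have "C * max (v \<theta> ^ d) (v \<theta> ^ n) \<le> v (lam x)"
      using lam_ge_outside[OF x] lam_ge_coeff[OF x(1) assms(2) False] by (simp add: max_def)
    moreover have "coeff (sel x) n \<in> Fq q"
      using x(1) assms(2) by (auto simp: Apoly_def)
    ultimately show ?thesis
      using power_quotient_bound[OF assms(1)] False
      by (simp add: v_mult v_inverse v_power v_Fq divide_inverse)
  qed (use C_pos in simp)
qed (use C_pos in simp)

text \<open>The box without its smaller box is invariant under translating the coordinate other than
  \<open>sel\<close> by constants, so the terms cancel along lines.\<close>

lemma tail_bound_weight_1:
  assumes "sel \<in> {fst, snd}" "1 \<le> d" "d \<le> D"
  shows "v (\<theta> ^ n * (\<Sum>x\<in>box D - box d. inverse (lam x) * coeff (sel x) n))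
    \<le> max 1 (v z) * inverse (C ^ 2) / v \<theta> ^ d"
proof -
  \<comment> \<open>Dropping the pairs with vanishing \<open>n\<close>-th coefficient adds the lower
    bound C|\<theta>|^n. The set stays stable, because the shift fixes \<open>sel x\<close>.\<close>
  define X where "X = {x \<in> Adeg D \<times> Adeg D - Adeg d \<times> Adeg d. coeff (sel x) n \<noteq> 0}"
  define m where "m = C * max (v \<theta> ^ d) (v \<theta> ^ n)"
  have m: "0 < m"
    using C_pos by (simp add: m_def less_max_iff_disj)
  have XA: "x \<in> Apoly q \<times> Apoly q" if "x \<in> X" for x
    using that Adeg_subset by (auto simp: X_def)
  have X_ge: "m \<le> v (lam x)" if "x \<in> X" for x
    using lam_ge_outside[OF XA[OF that], of d] lam_ge_coeff[OF XA[OF that] assms(1), of n] that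
    by (simp add: m_def X_def max_def)
  have coeff_Fq: "coeff (fst x) i \<in> Fq q" "coeff (snd x) i \<in> Fq q" if "x \<in> X" for x i
    using XA[OF that] by (auto simp: Apoly_def)
  have coeff_le: "v (coeff (sel x) n) \<le> 1" if "x \<in> X" for x
    using coeff_Fq[OF that] assms(1) by (auto intro: v_Fq_le)
  note shift = Adeg_add_const_iff[OF assms(2)] Adeg_add_const_iff[OF order_trans[OF assms(2,3)]]
  have "v (\<Sum>x\<in>X. inverse (lam x) * coeff (sel x) n) \<le> max 1 (v z) / m ^ 2"
  proof (cases "sel = fst")
    case True
    have "v (\<Sum>x\<in>X. inverse (lam x) * coeff (sel x) n) \<le> v 1 / m ^ 2"
      by (rule orbit_sum_bound[where \<tau> = "\<lambda>c x. (fst x, snd x + [:c:])" and r = "\<lambda>x. coeff (snd x) 0"])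
        (use m X_ge coeff_le coeff_Fq True in
          \<open>auto simp: X_def shift mem_Times_iff algebra_simps\<close>)
    also have "\<dots> \<le> max 1 (v z) / m ^ 2"
      by (intro divide_right_mono) auto
    finally show ?thesis .
  next
    case False
    then have sel: "sel = snd"
      using assms(1) by simp
    \<comment> \<open>Shifting \<open>a\<close> by \<open>c\<close> moves \<open>lam\<close> by
      \<open>c * z\<close>, whereas shifting \<open>b\<close> moved it by \<open>c\<close>. The two
      directions \<open>z\<close> and 1 are the source of the factor
      \<open>max 1 (v z)\<close>.\<close>
    have "v (\<Sum>x\<in>X. inverse (lam x) * coeff (sel x) n) \<le> v z / m ^ 2"
      by (rule orbit_sum_bound[where \<tau> = "\<lambda>c x. (fst x + [:c:], snd x)" and r = "\<lambda>x. coeff (fst x) 0"])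
        (use m X_ge coeff_le coeff_Fq sel in
          \<open>auto simp: X_def shift mem_Times_iff algebra_simps\<close>)
    also have "\<dots> \<le> max 1 (v z) / m ^ 2"
      by (intro divide_right_mono) auto
    finally show ?thesis .
  qed
  moreover have "(\<Sum>x\<in>box D - box d. inverse (lam x) * coeff (sel x) n)
      = (\<Sum>x\<in>X. inverse (lam x) * coeff (sel x) n)"
    unfolding box_diff[OF assms(3)] X_def
    by (rule sum.mono_neutral_right) (auto simp: finite_Adeg)
  ultimately have "v (\<Sum>x\<in>box D - box d. inverse (lam x) * coeff (sel x) n) \<le> max 1 (v z) / m ^ 2"
    by simp
  then have "v (\<theta> ^ n * (\<Sum>x\<in>box D - box d. inverse (lam x) * coeff (sel x) n))
      \<le> v \<theta> ^ n * (max 1 (v z) / m ^ 2)"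
    unfolding v_mult v_power by (rule mult_left_mono) simp
  also have "\<dots> = max 1 (v z) * (v \<theta> ^ n / m ^ 2)"
    by simp
  also have "\<dots> \<le> max 1 (v z) * (inverse (C ^ 2) / v \<theta> ^ d)"
    by (intro mult_left_mono power_quotient_bound) (auto simp: m_def)
  finally show ?thesis
    by simp
qed

text \<open>The box limit is left open, since it is found differently for the two
  coordinates.\<close>

lemma ev_vec_eis_weight_1:
  assumes "sel \<in> {fst, snd}"
    and "(\<lambda>d. v ((\<Sum>x\<in>box d. inverse (lam x) * poly (sel x) \<theta>) - L)) \<longlonglongrightarrow> 0"
  shows "ev_vec_eis v q \<theta> 1 sel z = L"
  unfolding ev_vec_eis_def vec_eis_coeff_def power_one_right
  using vanishing_inverse_lam_power[of 1] assms(2)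
  by (intro ev_eq_limit[OF assms(1) _ tail_bound_weight_1[OF assms(1)]]) simp_all

text \<open>One power of \<open>lam\<close> absorbs the numerator at the cost of 1/C, and weight
  \<open>k - 1 \<ge> 1\<close> remains. So the values at \<theta> can be summed over the lattice
  directly instead of coefficientwise in \<open>t\<close>.\<close>

lemma has_vsum_weight_ge_2:
  assumes "2 \<le> k" "sel \<in> {fst, snd}"
  shows "has_vsum v (\<lambda>x. inverse (lam x ^ k) * poly (sel x) \<theta>) lat (ev_vec_eis v q \<theta> k sel z)"
proof -
  have "vanishing (\<lambda>x. inverse (lam x ^ k) * poly (sel x) \<theta>) lat"
  proof (rule vanishing_mono[OF vanishing_inverse_lam_power[of "k - 1"], of "inverse C"])
    fix x assume x: "x \<in> lat"
    have "v (poly (sel x) \<theta>) \<le> inverse C * v (lam x)"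
      using v_sel_le[of x sel] x assms(2) C_pos by (auto simp: field_simps)
    then have "v (inverse (lam x ^ k)) * v (poly (sel x) \<theta>)
        \<le> v (inverse (lam x ^ k)) * (inverse C * v (lam x))"
      by (rule mult_left_mono) simp
    also have "\<dots> = inverse C * (v (inverse (lam x ^ k)) * v (lam x))"
      by simp
    also have "v (inverse (lam x ^ k)) * v (lam x) = v (inverse (lam x ^ (k - 1)))"
      unfolding v_mult[symmetric] using inverse_lam_power_mult[OF x] assms(1) by simp
    finally show "v (inverse (lam x ^ k) * poly (sel x) \<theta>)
        \<le> inverse C * v (inverse (lam x ^ (k - 1)))"
      by (simp only: v_mult)
  qed (use assms(1) C_pos in auto)
  then obtain l where l: "has_vsum v (\<lambda>x. inverse (lam x ^ k) * poly (sel x) \<theta>) lat l"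
    by (rule vanishing_has_vsum[OF complete])
  have "ev_vec_eis v q \<theta> k sel z = l"
    unfolding ev_vec_eis_def vec_eis_coeff_def
    using assms vanishing_inverse_lam_power[of k] has_vsum_exhaust[OF l box eventually_box]
    by (intro ev_eq_limit[OF assms(2) _ tail_bound_weight_ge_2[OF assms]]) simp_all
  with l show ?thesis by simp
qed

subsection \<open>The false Eisenstein series\<close>

lemma sum_inverse_lam_bound:
  assumes "X \<subseteq> Apoly q" "\<And>b c. b \<in> X \<Longrightarrow> c \<in> Fq q \<Longrightarrow> b + [:c:] \<in> X"
    and "0 < m" "\<And>b. b \<in> X \<Longrightarrow> m \<le> v (lam (a, b))"
  shows "v (\<Sum>b\<in>X. inverse (lam (a, b))) \<le> 1 / m ^ 2"
proof -
  have "v (\<Sum>b\<in>X. inverse (lam (a, b)) * 1) \<le> v 1 / m ^ 2"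
    by (rule orbit_sum_bound[where \<tau> = "\<lambda>c b. b + [:c:]" and r = "\<lambda>b. coeff b 0"])
      (use assms in \<open>auto simp: algebra_simps Apoly_def\<close>)
  then show ?thesis by simp
qed

text \<open>Both bounds hold for finite sums over sets stable under adding constants and pass to the
  limit: |\<open>lam\<close>| >= C|a| on the whole row, and |\<open>lam\<close>| >= C|\<theta>|^d
  off \<open>Adeg d\<close>. The squares leave room for the numerator \<open>a\<close>.\<close>

lemma inner_sum:
  assumes a: "a \<in> Apoly q" "a \<noteq> 0"
  obtains u where "has_vsum v (\<lambda>b. inverse (lam (a, b))) (Apoly q) u"
    and "v u \<le> 1 / (C * v (poly a \<theta>)) ^ 2"
    and "\<And>d. 1 \<le> d \<Longrightarrow> v (u - (\<Sum>b\<in>Adeg d. inverse (lam (a, b)))) \<le> 1 / (C * v \<theta> ^ d) ^ 2"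
proof -
  have "vanishing (\<lambda>b. inverse (lam (a, b))) (Apoly q)"
    unfolding vanishing_def
  proof (intro allI impI)
    fix e :: real assume "0 < e"
    then have "finite {x \<in> lat. e \<le> v (inverse (lam x))}"
      using vanishing_inverse_lam_power[of 1] by (simp add: vanishing_def)
    then have "finite (Pair a -` {x \<in> lat. e \<le> v (inverse (lam x))})"
      by (rule finite_vimageI) (simp add: inj_on_def)
    then show "finite {b \<in> Apoly q. e \<le> v (inverse (lam (a, b)))}"
      by (rule rev_finite_subset) (use a in auto)
  qed
  then obtain u where u: "has_vsum v (\<lambda>b. inverse (lam (a, b))) (Apoly q) u"
    by (rule vanishing_has_vsum[OF complete])
  let ?S = "\<lambda>d. \<Sum>b\<in>Adeg d. inverse (lam (a, b))"
  have lim: "(\<lambda>d. v (?S d - u)) \<longlonglongrightarrow> 0"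
    using u finite_Adeg Adeg_subset eventually_Adeg by (rule has_vsum_exhaust)
  have pos: "0 < v (poly a \<theta>)"
    using a by (simp add: poly_theta_eq_0_iff)
  have "v (?S d) \<le> 1 / (C * v (poly a \<theta>)) ^ 2" if "1 \<le> d" for d
  proof (rule sum_inverse_lam_bound)
    show "C * v (poly a \<theta>) \<le> v (lam (a, b))" if "b \<in> Adeg d" for b
      using v_sel_le[of "(a, b)" fst] a that Adeg_subset by auto
  qed (use C_pos pos Adeg_subset Adeg_add_const[OF that] in auto)
  then have bound: "v u \<le> 1 / (C * v (poly a \<theta>)) ^ 2"
    by (intro v_lim_le[OF lim]) (auto simp: eventually_sequentially)
  have "v (u - ?S d) \<le> 1 / (C * v \<theta> ^ d) ^ 2" if d: "1 \<le> d" for d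
  proof (rule v_lim_le)
    show "(\<lambda>D. v (?S D - ?S d - (u - ?S d))) \<longlonglongrightarrow> 0"
      using lim by simp
    have "v (?S D - ?S d) \<le> 1 / (C * v \<theta> ^ d) ^ 2" if D: "d \<le> D" for D
    proof -
      have "?S D - ?S d = (\<Sum>b\<in>Adeg D - Adeg d. inverse (lam (a, b)))"
        using Adeg_mono[OF D] by (simp add: sum_diff finite_Adeg)
      also have "v \<dots> \<le> 1 / (C * v \<theta> ^ d) ^ 2"
      proof (rule sum_inverse_lam_bound)
        show "C * v \<theta> ^ d \<le> v (lam (a, b))" if "b \<in> Adeg D - Adeg d" for b
          using lam_ge_outside[of "(a, b)" d] a that Adeg_subset by auto
        show "b + [:c:] \<in> Adeg D - Adeg d" if "b \<in> Adeg D - Adeg d" "c \<in> Fq q" for b c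
          using that d D by (simp add: Adeg_add_const_iff)
      qed (use C_pos Adeg_subset in auto)
      finally show ?thesis .
    qed
    then show "\<forall>\<^sub>F D in sequentially. v (?S D - ?S d) \<le> 1 / (C * v \<theta> ^ d) ^ 2"
      by (auto simp: eventually_sequentially)
  qed
  with u bound show thesis
    by (rule that)
qed

text \<open>Multiplying \<open>a\<close> by a nonzero constant does not change its row sum, so the
  nonzero rows of a box collapse to minus the monic ones. Finite rows approximate infinite ones
  uniformly in \<open>a\<close>, so the limit over boxes meets the iterated sum
  \<open>G\<close>.\<close>

lemma sum_fst_tendsto_false_eis:
  defines "G \<equiv> vsum v (\<lambda>a. vsum v (\<lambda>b. poly a \<theta> / (poly a \<theta> * z + poly b \<theta>)) (Apoly q)) (Amonic q)"
  shows "(\<lambda>d. v ((\<Sum>x\<in>box d. inverse (lam x) * poly (fst x) \<theta>) - (- G))) \<longlonglongrightarrow> 0"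
proof -
  define g where "g a = vsum v (\<lambda>b. poly a \<theta> / (poly a \<theta> * z + poly b \<theta>)) (Apoly q)" for a
  define h where "h d a = (\<Sum>b\<in>Adeg d. inverse (lam (a, b)) * poly a \<theta>)" for d a
  have g: "v (g a) \<le> inverse (C ^ 2) / v (poly a \<theta>)"
    "\<And>d. 1 \<le> d \<Longrightarrow> a \<in> Adeg d \<Longrightarrow> v (h d a - g a) \<le> inverse (C ^ 2) / v \<theta> ^ d"
    if a: "a \<in> Amonic q" for a
  proof -
    have a': "a \<in> Apoly q" "a \<noteq> 0"
      using a by (auto simp: Amonic_def)
    then have pos: "0 < v (poly a \<theta>)"
      by (simp add: poly_theta_eq_0_iff)
    obtain u where u: "has_vsum v (\<lambda>b. inverse (lam (a, b))) (Apoly q) u"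
      "v u \<le> 1 / (C * v (poly a \<theta>)) ^ 2"
      "\<And>d. 1 \<le> d \<Longrightarrow> v (u - (\<Sum>b\<in>Adeg d. inverse (lam (a, b)))) \<le> 1 / (C * v \<theta> ^ d) ^ 2"
      by (rule inner_sum[OF a']) (rule that)
    have gu: "g a = poly a \<theta> * u"
      unfolding g_def using has_vsum_cmult[OF u(1), of "poly a \<theta>"]
      by (intro vsum_eqI) (simp add: divide_inverse)
    have "v (g a) \<le> v (poly a \<theta>) * (1 / (C * v (poly a \<theta>)) ^ 2)"
      unfolding gu v_mult by (intro mult_left_mono u(2)) simp
    also have "\<dots> = inverse (C ^ 2) / v (poly a \<theta>)"
      using C_pos pos by (simp add: field_simps power2_eq_square)
    finally show "v (g a) \<le> inverse (C ^ 2) / v (poly a \<theta>)" .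
    show "v (h d a - g a) \<le> inverse (C ^ 2) / v \<theta> ^ d" if d: "1 \<le> d" "a \<in> Adeg d" for d
    proof -
      have "h d a - g a = - (poly a \<theta> * (u - (\<Sum>b\<in>Adeg d. inverse (lam (a, b)))))"
        by (simp add: h_def gu algebra_simps sum_distrib_left)
      then have "v (h d a - g a) = v (poly a \<theta>) * v (u - (\<Sum>b\<in>Adeg d. inverse (lam (a, b))))"
        by (simp only: v_minus v_mult)
      \<comment> \<open>The numerator uses up one of the two powers in the row estimate; the error
        left over does not depend on \<open>a\<close>.\<close>
      also have "\<dots> \<le> v \<theta> ^ d * (1 / (C * v \<theta> ^ d) ^ 2)"
        by (intro mult_mono v_poly_le_Adeg u(3) d) auto
      also have "\<dots> = inverse (C ^ 2) / v \<theta> ^ d"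
        using C_pos by (simp add: field_simps power2_eq_square)
      finally show ?thesis .
    qed
  qed
  have "vanishing g (Amonic q)"
    unfolding vanishing_def
  proof (intro allI impI)
    fix e :: real assume e: "0 < e"
    obtain d where d: "inverse (C ^ 2) / e < v \<theta> ^ d"
      using real_arch_pow[OF v_theta] by blast
    have "a \<in> Adeg d" if a: "a \<in> Amonic q" "e \<le> v (g a)" for a
    proof (rule ccontr)
      assume "a \<notin> Adeg d"
      then have "v \<theta> ^ d \<le> v (poly a \<theta>)"
        using a(1) by (intro v_poly_ge_notin_Adeg) (auto simp: Amonic_def)
      with d have lt: "inverse (C ^ 2) / e < v (poly a \<theta>)"
        by linarith
      moreover have "0 < inverse (C ^ 2) / e"
        using C_pos e by simp
      ultimately have "0 < v (poly a \<theta>)"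
        by linarith
      with lt have "inverse (C ^ 2) / v (poly a \<theta>) < e"
        using e by (simp add: pos_divide_less_eq mult.commute)
      then show False
        using g(1)[OF a(1)] a(2) by linarith
    qed
    then show "finite {a \<in> Amonic q. e \<le> v (g a)}"
      by (intro finite_subset[OF _ finite_Adeg[of d]]) blast
  qed
  then have G: "has_vsum v g (Amonic q) G"
    unfolding G_def g_def[symmetric] by (rule has_vsum_vsum[OF complete])
  have "(\<lambda>d. v (sum g (Adeg d \<inter> Amonic q) - G)) \<longlonglongrightarrow> 0"
    using eventually_Adeg
    by (intro has_vsum_exhaust[OF G]) (auto simp: finite_Adeg Amonic_def elim!: eventually_mono)
  then have "(\<lambda>d. v (sum (h d) (Adeg d \<inter> Amonic q) - G)) \<longlonglongrightarrow> 0"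
  proof (rule v_lim_close)
    show "(\<lambda>d. inverse (C ^ 2) / v \<theta> ^ d) \<longlonglongrightarrow> 0"
      using v_theta by (rule LIMSEQ_divide_realpow_zero)
    have "v (sum (h d) (Adeg d \<inter> Amonic q) - sum g (Adeg d \<inter> Amonic q)) \<le> inverse (C ^ 2) / v \<theta> ^ d"
      if "1 \<le> d" for d
      unfolding sum_subtractf[symmetric] using g(2) that C_pos by (intro v_sum_le) auto
    then show "\<forall>\<^sub>F d in sequentially. v (sum (h d) (Adeg d \<inter> Amonic q) - sum g (Adeg d \<inter> Amonic q))
        \<le> inverse (C ^ 2) / v \<theta> ^ d"
      by (auto simp: eventually_sequentially)
  qed
  moreover have "(\<Sum>x\<in>box d. inverse (lam x) * poly (fst x) \<theta>) = - sum (h d) (Adeg d \<inter> Amonic q)" for d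
  proof -
    have "(\<Sum>x\<in>box d. inverse (lam x) * poly (fst x) \<theta>)
        = (\<Sum>x\<in>(Adeg d - {0}) \<times> Adeg d. inverse (lam x) * poly (fst x) \<theta>)"
      by (rule sum.mono_neutral_right) (auto simp: finite_Adeg)
    also have "\<dots> = sum (h d) (Adeg d - {0})"
      by (simp add: h_def sum.cartesian_product case_prod_unfold)
    also have "\<dots> = - sum (h d) (Adeg d \<inter> Amonic q)"
    proof (rule sum_Adeg_monic)
      fix c :: 'c and a assume c: "c \<in> Fq q" "c \<noteq> 0"
      \<comment> \<open>\<open>b\<close> is rescaled along with \<open>a\<close>, because
        \<open>a / lam\<close> is homogeneous of degree zero.\<close>
      have "bij_betw (smult c) (Adeg d) (Adeg d)"
        by (rule bij_betw_byWitness[where f' = "smult (inverse c)"])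
          (use c in \<open>auto simp: Adeg_smult Fq_inverse\<close>)
      then have "h d (smult c a)
          = (\<Sum>b\<in>Adeg d. inverse (lam (smult c a, smult c b)) * poly (smult c a) \<theta>)"
        unfolding h_def by (rule sum.reindex_bij_betw[symmetric])
      also have "\<dots> = h d a"
        unfolding h_def
      proof (rule sum.cong)
        fix b
        have "lam (smult c a, smult c b) = c * lam (a, b)"
          by (simp add: algebra_simps)
        then show "inverse (lam (smult c a, smult c b)) * poly (smult c a) \<theta>
            = inverse (lam (a, b)) * poly a \<theta>"
          using c(2) by simp
      qed simp
      finally show "h d (smult c a) = h d a" .
    qed
    finally show ?thesis .
  qed
  ultimately show ?thesis
    by (simp add: v_diff_commute)
qed

lemma sum_snd_tendsto:
  assumes "(\<lambda>d. v ((\<Sum>x\<in>box d. inverse (lam x) * poly (fst x) \<theta>) - L)) \<longlonglongrightarrow> 0"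
  shows "(\<lambda>d. v ((\<Sum>x\<in>box d. inverse (lam x) * poly (snd x) \<theta>) - (- 1 - z * L))) \<longlonglongrightarrow> 0"
proof -
  have eq: "(\<Sum>x\<in>box d. inverse (lam x) * poly (snd x) \<theta>)
      = - 1 + (- z) * (\<Sum>x\<in>box d. inverse (lam x) * poly (fst x) \<theta>)" if d: "1 \<le> d" for d
  proof -
    have "(\<Sum>x\<in>box d. inverse (lam x) * poly (snd x) \<theta>)
        + z * (\<Sum>x\<in>box d. inverse (lam x) * poly (fst x) \<theta>) = (\<Sum>x\<in>box d. inverse (lam x) * lam x)"
      by (simp add: sum_distrib_left algebra_simps flip: sum.distrib)
    also have "\<dots> = (\<Sum>x\<in>box d. 1)"
    proof (rule sum.cong)
      fix x assume "x \<in> box d"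
      then have "lam x \<noteq> 0"
        using lam_nonzero box(2) by blast
      then show "inverse (lam x) * lam x = 1"
        by (rule left_inverse)
    qed simp
    \<comment> \<open>The box is a square with one point removed, and the side \<open>Adeg d\<close>
      has zero elements modulo \<open>p\<close> as soon as \<open>d \<ge> 1\<close>.\<close>
    also have "\<dots> = - 1"
      by (subst sum_diff1) (simp_all add: finite_Adeg card_cartesian_product card_Adeg[OF d])
    finally show ?thesis
      by (simp add: algebra_simps)
  qed
  have "(\<lambda>d. v (- 1 + (- z) * (\<Sum>x\<in>box d. inverse (lam x) * poly (fst x) \<theta>)
      - (- 1 + (- z) * L))) \<longlonglongrightarrow> 0"
    by (intro v_lim_add v_lim_cmult assms) simp
  then show ?thesis
  proof (rule Lim_transform_eventually)
    show "\<forall>\<^sub>F d in sequentially.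
        v (- 1 + (- z) * (\<Sum>x\<in>box d. inverse (lam x) * poly (fst x) \<theta>) - (- 1 + (- z) * L))
        = v ((\<Sum>x\<in>box d. inverse (lam x) * poly (snd x) \<theta>) - (- 1 - z * L))"
      using eventually_ge_at_top[of 1] by eventually_elim (simp only: eq mult_minus_left diff_conv_add_uminus)
  qed
qed

subsection \<open>Derivative of the Eisenstein series\<close>

text \<open>Moving from \<open>z\<close> to \<open>w\<close> multiplies \<open>lam x\<close> by
  \<open>1 + s x\<close> with |s x| < 1. The Taylor errors are bounded uniformly over the lattice,
  and the ultrametric inequality hands this bound to the sum.\<close>

lemma has_vderiv_goss_eis:
  assumes n: "1 \<le> n"
    and H: "has_vsum v (\<lambda>x. inverse (lam x ^ Suc n) * poly (fst x) \<theta>) lat H"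
  shows "has_vderiv v (goss_eis v q \<theta> n) z (- of_nat n * H)"
proof (rule has_vderivI[OF C_pos])
  fix w assume w: "w \<noteq> z" "v (w - z) < C"
  define y where "y = w - z"
  let ?lw = "\<lambda>x. poly (fst x) \<theta> * w + poly (snd x) \<theta>"
  define s where "s x = poly (fst x) \<theta> * y / lam x" for x
  have y: "y \<noteq> 0" "v y < C"
    using w by (auto simp: y_def)
  have s: "v (s x) \<le> v y / C" "v (s x) < 1" "?lw x = lam x * (1 + s x)" if x: "x \<in> lat" for x
  proof -
    have "v (poly (fst x) \<theta>) \<le> v (lam x) / C"
      using v_sel_le[of x fst] x C_pos by (auto simp: field_simps)
    then have "v (s x) \<le> v (lam x) / C * v y / v (lam x)"
      unfolding s_def v_divide v_mult by (intro divide_right_mono mult_right_mono) auto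
    then show "v (s x) \<le> v y / C"
      using lam_nonzero[OF x] by simp
    also have "\<dots> < 1"
      using y C_pos by simp
    finally show "v (s x) < 1" .
    have "lam x * s x = poly (fst x) \<theta> * y"
      using lam_nonzero[OF x] by (simp add: s_def)
    then show "?lw x = lam x * (1 + s x)"
      unfolding distrib_left by (simp add: y_def right_diff_distrib)
  qed
  \<comment> \<open>The terms at \<open>w\<close> have the same absolute values as those at
    \<open>z\<close>, so convergence at \<open>w\<close> is inherited.\<close>
  have v_lw: "v (?lw x) = v (lam x)" if "x \<in> lat" for x
    using s(2,3)[OF that] v_add_eq_left[of "s x" 1] by (simp add: v_mult)
  have van: "vanishing (\<lambda>x. inverse (lam x ^ n)) lat"
    using n by (rule vanishing_inverse_lam_power)
  then have "vanishing (\<lambda>x. inverse (?lw x ^ n)) lat"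
    by (rule vanishing_mono[of _ _ 1]) (simp_all add: v_inverse v_power v_lw)
  then have sum_w: "has_vsum v (\<lambda>x. inverse (?lw x ^ n)) lat (goss_eis v q \<theta> n w)"
    unfolding goss_eis_def case_prod_unfold by (rule has_vsum_vsum[OF complete])
  have sum_z: "has_vsum v (\<lambda>x. inverse (lam x ^ n)) lat (goss_eis v q \<theta> n z)"
    unfolding goss_eis_def case_prod_unfold by (rule has_vsum_vsum[OF complete van])
  let ?t = "\<lambda>x. inverse y * (inverse (?lw x ^ n) - inverse (lam x ^ n))
      - (- of_nat n) * (inverse (lam x ^ Suc n) * poly (fst x) \<theta>)"
  have sum_t: "has_vsum v ?t lat
      (inverse y * (goss_eis v q \<theta> n w - goss_eis v q \<theta> n z) - (- of_nat n) * H)"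
    by (intro has_vsum_diff has_vsum_cmult sum_w sum_z H)
  have "v (?t x) \<le> inverse (C ^ n * C ^ 2) * v y" if x: "x \<in> lat" for x
  proof -
    let ?r = "inverse ((1 + s x) ^ n) - 1 + of_nat n * s x"
    have "s x * inverse y = inverse (lam x) * poly (fst x) \<theta>"
      using y(1) by (simp add: s_def divide_inverse)
    \<comment> \<open>A polynomial identity in free letters: \<open>p\<close> stands for the power
      of \<open>inverse (lam x)\<close>, \<open>i\<close> for \<open>inverse y\<close>,
      \<open>t\<close> for the inverse power of \<open>1 + s x\<close>, \<open>m\<close> for
      \<open>of_nat n\<close> and \<open>u\<close> for \<open>s x\<close>.\<close>
    moreover have "p * i * (t - 1 + m * u) = i * (p * t - p) + m * (p * (u * i))" for p i t m u :: 'c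
      by (simp add: algebra_simps)
    ultimately have "inverse (lam x ^ n) * inverse y * ?r
        = inverse y * (inverse (lam x ^ n) * inverse ((1 + s x) ^ n) - inverse (lam x ^ n))
          + of_nat n * (inverse (lam x ^ n) * (inverse (lam x) * poly (fst x) \<theta>))"
      by (simp only:)
    then have "?t x = inverse (lam x ^ n) * inverse y * ?r"
      unfolding s(3)[OF x] power_mult_distrib inverse_mult_distrib power_Suc2
      by (simp only: mult.assoc mult_minus_left diff_minus_eq_add)
    then have "v (?t x) = inverse (v (lam x) ^ n) * inverse (v y) * v ?r"
      by (simp only: v_mult v_inverse v_power)
    \<comment> \<open>One of the two factors |y| of the Taylor remainder cancels
      \<open>inverse (v y)\<close>, which leaves an error linear in |y|.\<close>
    also have "\<dots> \<le> inverse (C ^ n) * inverse (v y) * (v y / C) ^ 2"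
    proof (intro mult_mono)
      show "inverse (v (lam x) ^ n) \<le> inverse (C ^ n)"
        using lam_ge[OF x] C_pos by (intro le_imp_inverse_le power_mono) auto
      have "v ?r \<le> v (s x) ^ 2"
        by (rule v_inverse_power_taylor[OF s(2)[OF x]])
      also have "\<dots> \<le> (v y / C) ^ 2"
        using s(1)[OF x] by (intro power_mono) auto
      finally show "v ?r \<le> (v y / C) ^ 2" .
    qed (use C_pos in auto)
    also have "\<dots> = inverse (C ^ n * C ^ 2) * v y"
      using y(1) C_pos by (simp add: field_simps power2_eq_square)
    finally show ?thesis .
  qed
  from has_vsum_bound[OF sum_t this]
  have "v (inverse y * (goss_eis v q \<theta> n w - goss_eis v q \<theta> n z) - (- of_nat n) * H)
      \<le> inverse (C ^ n * C ^ 2) * v y"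
    using C_pos by simp
  then show "v ((goss_eis v q \<theta> n w - goss_eis v q \<theta> n z) / (w - z) - - of_nat n * H)
      \<le> inverse (C ^ n * C ^ 2) * v (w - z)"
    by (simp only: y_def divide_inverse mult.commute[of _ "inverse (w - z)"])
qed

lemma goss_eis_eq:
  assumes "2 \<le> k"
  shows "goss_eis v q \<theta> (k - 1) z = z * ev_vec_eis v q \<theta> k fst z + ev_vec_eis v q \<theta> k snd z"
proof -
  have "has_vsum v (\<lambda>x. z * (inverse (lam x ^ k) * poly (fst x) \<theta>) + inverse (lam x ^ k) * poly (snd x) \<theta>)
      lat (z * ev_vec_eis v q \<theta> k fst z + ev_vec_eis v q \<theta> k snd z)"
    by (intro has_vsum_add has_vsum_cmult has_vsum_weight_ge_2[OF assms]) simp_all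
  moreover have "z * (inverse (lam x ^ k) * poly (fst x) \<theta>) + inverse (lam x ^ k) * poly (snd x) \<theta>
      = inverse (lam x ^ (k - 1))" if x: "x \<in> lat" for x
  proof -
    have "z * (inverse (lam x ^ k) * poly (fst x) \<theta>) + inverse (lam x ^ k) * poly (snd x) \<theta>
        = inverse (lam x ^ k) * lam x"
      by (simp add: algebra_simps)
    then show ?thesis
      using inverse_lam_power_mult[OF x] assms by simp
  qed
  ultimately have "has_vsum v (\<lambda>x. inverse (lam x ^ (k - 1))) lat
      (z * ev_vec_eis v q \<theta> k fst z + ev_vec_eis v q \<theta> k snd z)"
    by (subst (asm) has_vsum_cong)
  then show ?thesis
    unfolding goss_eis_def case_prod_unfold by (rule vsum_eqI)
qed

end

section \<open>The identity at a point of \<Omega>\<close>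

theorem proposition3p24:
  fixes v :: "'c::field \<Rightarrow> real" and q k :: nat and \<theta> \<pi> z :: 'c
  assumes "Cinf_setting v q \<theta>"
    and "carlitz_period v q \<theta> \<pi>"
    and "1 < k"
    and "k mod (q - 1) = 1 mod (q - 1)"
    and "z \<in> Omega v q \<theta>"
  shows "det2 (ev_vec_eis v q \<theta> 1 fst z) (ev_vec_eis v q \<theta> 1 snd z)
              (of_nat (k - 1) * ev_vec_eis v q \<theta> k fst z) (of_nat (k - 1) * ev_vec_eis v q \<theta> k snd z)
         = - \<pi> * rs_deriv v q \<theta> \<pi> (int k - 1) (goss_eis v q \<theta> (k - 1)) z"
proof -
  interpret cinf v q \<theta>
    using assms(1) by unfold_locales
  obtain C where "0 < C" "\<And>a b. a \<in> Apoly q \<Longrightarrow> b \<in> Apoly q \<Longrightarrow>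
      C * max (v (poly a \<theta>)) (v (poly b \<theta>)) \<le> v (poly a \<theta> * z + poly b \<theta>)"
    using Omega_lower_bound[OF assms(5)] by blast
  then interpret cinf_point v q \<theta> z C
    by unfold_locales
  define G where "G = vsum v (\<lambda>a. vsum v (\<lambda>b. poly a \<theta> / (poly a \<theta> * z + poly b \<theta>)) (Apoly q)) (Amonic q)"
  define H1 H2 where "H1 = ev_vec_eis v q \<theta> k fst z" and "H2 = ev_vec_eis v q \<theta> k snd z"
  define n :: 'c where "n = of_nat (k - 1)"
  have k: "2 \<le> k" "Suc (k - 1) = k"
    using assms(3) by auto
  have ev_fst: "ev_vec_eis v q \<theta> 1 fst z = - G"
    unfolding G_def by (rule ev_vec_eis_weight_1[OF _ sum_fst_tendsto_false_eis]) simp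
  have ev_snd: "ev_vec_eis v q \<theta> 1 snd z = - 1 - z * (- G)"
    unfolding G_def
    by (rule ev_vec_eis_weight_1[OF _ sum_snd_tendsto[OF sum_fst_tendsto_false_eis]]) simp
  have "has_vderiv v (goss_eis v q \<theta> (k - 1)) z (- n * H1)"
    unfolding n_def H1_def using has_vsum_weight_ge_2[OF k(1), of fst] k
    by (intro has_vderiv_goss_eis) auto
  then have deriv: "vderiv v (goss_eis v q \<theta> (k - 1)) z = - n * H1"
    using v_theta by (rule vderiv_eqI)
  \<comment> \<open>As \<open>k > 1\<close>, the natural subtraction is not truncated and the two
    coefficients agree.\<close>
  have n: "of_int (int k - 1) = n"
    using assms(3) by (simp add: n_def of_nat_diff)
  have false_eis: "false_eis v q \<theta> \<pi> z = inverse \<pi> * G"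
    by (simp only: false_eis_def G_def)
  have "\<pi> \<noteq> 0"
    using assms(2) by (simp add: carlitz_period_def)
  \<comment> \<open>Both sides become \<open>n * H1 - n * G * (z * H1 + H2)\<close>. The
    \<open>- 1\<close> in the second coordinate of weight one yields the derivative term, and the
    multiples of \<open>G\<close> yield the false Eisenstein term.\<close>
  then show ?thesis
    unfolding det2_def rs_deriv_def ev_fst ev_snd deriv goss_eis_eq[OF k(1)] n false_eis
      H1_def[symmetric] H2_def[symmetric] n_def[symmetric]
    by (simp add: field_simps)
qed

end
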